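(* Let $\varepsilon\in(0,1)$ be fixed and let $p=p(n)$ satisfy $$p \gg \frac{(\log n)^2(\log(np))^2}{n}\qquad\text{and}\qquad p\le 1-\varepsilon .$$ Let $G\in\mathcal{G}(n,p)$. Then the following hold asymptotically almost surely. (i) If $p\in(0,1-\varepsilon]$ is a constant, then $\chi_s(G)\sim r\lg n$, where $r=r(p)=\dfrac{2}{\lg(1/s)}$ and $$s=s(p)=\min\Big\{[(1-p)^\ell]^2+[1-(1-p)^\ell]^2:\ \ell\in\mathbb{N}\Big\}.$$ (ii) If $p=o(1)$ and $np=n^{\alpha+o(1)}$ for some $\alpha\in(0,1]$, then $$(2\alpha+o(1))\lg n\le \chi_s(G)\le (1+\alpha+o(1))\lg n.$$ (iii) If $np=n^{o(1)}$, then $$2\big(\lg(np)-\lg\log n-\lg\log(np)\big)\le \chi_s(G)\le (1+o(1))\lg n.$$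
   Context: For a graph $G=(V,E)$ and a (not necessarily proper) colouring $c:V\to[k]$, the neighbourhood colour set of $v$ is $C(v)=\{c(u):uv\in E\}$. The colouring is a set colouring if $C(u)\neq C(v)$ for every edge $uv$. The set chromatic number $\chi_s(G)$ is the minimum $k$ such that $G$ has a set colouring with $k$ colours. $\mathcal{G}(n,p)$ is the binomial random graph on vertex set $[n]$ in which each pair is an edge independently with probability $p$. An event holds asymptotically almost surely (a.a.s.) if its probability tends to $1$ as $n\to\infty$. All asymptotic notation is as $n\to\infty$; $f\sim g$ means $f/g\to1$; $f\gg g$ means $f/g\to\infty$. $\lg$ denotes logarithm base 2 and $\log$ the natural logarithm.
   Formalization: Part (iii) is proved under the additional assumption that np tends to infinity; without it p=(1+1/n)/n meets the stated hypotheses for large n, but the lower bound (2+o(1))lg n contradicts the upper bound (1+o(1))lg n. *)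

theory Defs
  imports "HOL-Probability.Probability" "HOL-Library.Landau_Symbols"
begin

text \<open>A graph is a pair of a vertex set and a set of two-element sets of vertices.\<close>

type_synonym 'a ugraph = "'a set \<times> 'a set set"

abbreviation verts :: "'a ugraph \<Rightarrow> 'a set" where "verts \<equiv> fst"
abbreviation edges :: "'a ugraph \<Rightarrow> 'a set set" where "edges \<equiv> snd"

definition pairs :: "'a set \<Rightarrow> 'a set set" where
  "pairs V = {e. e \<subseteq> V \<and> card e = 2}"

definition simple_graph :: "'a ugraph \<Rightarrow> bool" where
  "simple_graph G \<longleftrightarrow> edges G \<subseteq> pairs (verts G)"

definition nbr_colours :: "'a ugraph \<Rightarrow> ('a \<Rightarrow> nat) \<Rightarrow> 'a \<Rightarrow> nat set" where
  "nbr_colours G c v = {c u |u. {u, v} \<in> edges G}"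

definition set_colouring :: "'a ugraph \<Rightarrow> nat \<Rightarrow> ('a \<Rightarrow> nat) \<Rightarrow> bool" where
  "set_colouring G k c \<longleftrightarrow>
     c \<in> verts G \<rightarrow> {1..k} \<and>
     (\<forall>u v. {u, v} \<in> edges G \<longrightarrow> nbr_colours G c u \<noteq> nbr_colours G c v)"

definition set_chromatic_number :: "'a ugraph \<Rightarrow> nat" where
  "set_chromatic_number G = (LEAST k. \<exists>c. set_colouring G k c)"

text \<open>The minimum ranges over a nonempty set: an injective colouring is a set colouring.\<close>

lemma ex_set_colouring:
  assumes "simple_graph G" "finite (verts G)"
  shows "\<exists>c. set_colouring G (card (verts G)) c"
proof -
  obtain c where c: "bij_betw c (verts G) {1..card (verts G)}"
    using assms(2) finite_same_card_bij[of "verts G" "{1..card (verts G)}"] by auto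
  have "nbr_colours G c u \<noteq> nbr_colours G c v" if uv: "{u, v} \<in> edges G" for u v
  proof
    assume eq: "nbr_colours G c u = nbr_colours G c v"
    have "c v \<in> nbr_colours G c u"
      using uv by (auto simp: nbr_colours_def insert_commute)
    then obtain w where w: "c v = c w" "{w, v} \<in> edges G"
      unfolding eq by (auto simp: nbr_colours_def)
    have wv: "w \<in> verts G" "v \<in> verts G" "card {w, v} = 2"
      using w(2) assms(1) unfolding simple_graph_def pairs_def by auto
    then have "w = v" using w(1) c by (auto simp: bij_betw_def inj_on_def)
    with wv(3) show False by simp
  qed
  then show ?thesis
    using bij_betwE[OF c] unfolding set_colouring_def by blast
qed

text \<open>The function \<open>b\<close> says which pairs are edges; its values are independent.\<close>

definition random_graph :: "nat \<Rightarrow> real \<Rightarrow> nat ugraph pmf" where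
  "random_graph n p =
     map_pmf (\<lambda>b. ({1..n}, {e \<in> pairs {1..n}. b e}))
       (Pi_pmf (pairs {1..n}) False (\<lambda>_. bernoulli_pmf p))"

definition aas :: "(nat \<Rightarrow> real) \<Rightarrow> (nat \<Rightarrow> nat ugraph \<Rightarrow> bool) \<Rightarrow> bool" where
  "aas p P \<longleftrightarrow>
     (\<lambda>n. measure_pmf.prob (random_graph n (p n)) {G. P n G}) \<longlonglongrightarrow> 1"

definition s_val :: "real \<Rightarrow> nat \<Rightarrow> real" where
  "s_val p l = ((1 - p) ^ l)\<^sup>2 + (1 - (1 - p) ^ l)\<^sup>2"

text \<open>
  For \<open>0 < p < 1\<close> the minimum is attained (lemma \<open>s_const_attained\<close>), and at some \<open>l \<ge> 1\<close>,
  since \<open>l = 0\<close> gives the value 1; so it does not matter whether \<open>l\<close> starts at 0 or at 1.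
\<close>

definition s_const :: "real \<Rightarrow> real" where
  "s_const p = (LEAST x. x \<in> range (s_val p))"

definition r_const :: "real \<Rightarrow> real" where
  "r_const p = 2 / log 2 (1 / s_const p)"

lemma s_const_attained:
  assumes "0 < p" "p < 1"
  shows "\<exists>l\<ge>1. s_const p = s_val p l" and "s_const p \<le> s_val p l" and "s_const p < 1"
proof -
  have one: "s_val p 1 < s_val p 0"
    using assms mult_strict_left_mono[of p 1 p]
    by (simp add: s_val_def power2_eq_square algebra_simps)
  have L: "(\<lambda>l. (1 - p) ^ l) \<longlonglongrightarrow> 0"
    using assms by (intro LIMSEQ_realpow_zero) auto
  have "s_val p \<longlonglongrightarrow> 0\<^sup>2 + (1 - 0)\<^sup>2"
    unfolding s_val_def by (intro tendsto_add tendsto_power tendsto_diff tendsto_const L)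
  then have lim: "s_val p \<longlonglongrightarrow> 1" by simp
  have v0: "s_val p 0 = 1" by (simp add: s_val_def)
  have "\<forall>\<^sub>F l in sequentially. s_val p 1 < s_val p l"
    using order_tendstoD(1)[OF lim] one v0 by simp
  then obtain N where N: "\<And>l. l \<ge> N \<Longrightarrow> s_val p 1 < s_val p l"
    by (auto simp: eventually_sequentially)
  let ?M = "Min (s_val p ` {1..Suc N})"
  have "?M \<in> s_val p ` {1..Suc N}" by (intro Min_in) auto
  then obtain m where m: "m \<ge> 1" "s_val p m = ?M"
    by (metis (no_types, lifting) atLeastAtMost_iff imageE)
  have le1: "s_val p m \<le> s_val p l" if "l \<in> {1..Suc N}" for l
    unfolding m(2) using that by (intro Min_le) auto
  have le: "s_val p m \<le> s_val p l" for l
  proof (cases "l \<in> {1..Suc N}")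
    case False
    then have "l = 0 \<or> l \<ge> N" by auto
    then have "s_val p 1 < s_val p l" using one N by auto
    with le1[of 1] show ?thesis by simp
  qed (rule le1)
  have eq: "s_const p = s_val p m"
    unfolding s_const_def by (rule Least_equality) (use le in auto)
  show "\<exists>l\<ge>1. s_const p = s_val p l" using eq m by blast
  show "s_const p \<le> s_val p l" using eq le by simp
  show "s_const p < 1" using eq le[of 1] one v0 by simp
qed

end

theory Submission
  imports Defs "HOL-Real_Asymp.Real_Asymp"
begin

text \<open>
  Upper bounds: give each of \<open>K\<close> colours to \<open>l\<close> vertices and one further colour to all others. For each
  pair \<open>u\<close>, \<open>v\<close>, at least \<open>K - 2\<close> of the small classes avoid the colours of \<open>u\<close> and \<open>v\<close>, and each of them
  fails to distinguish the two vertices with probability \<open>s_val p l\<close>, independently. So the expected number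
  of bad edges is at most \<open>n\<^sup>2 p (s_val p l)\<^bsup>K-2\<^esup>\<close>. For \<open>p \<rightarrow> 0\<close> choose \<open>l\<close> with \<open>(1 - p)\<^sup>l \<approx> 1/2\<close>.

  Lower bounds: a union bound over all colourings is too expensive. But any two disjoint sets of
  \<open>K \<approx> 3 ln n / p\<close> vertices are joined by an edge, so every colour class of at least \<open>K\<close> vertices is seen by all
  but \<open>2K\<close> vertices. Hence outside some set \<open>S\<close> of \<open>2kK\<close> vertices the neighbourhood colour set of \<open>u\<close> is
  determined by its type, the set of colours of its neighbours in \<open>S\<close>, and a union bound over \<open>S\<close> and the
  colouring of \<open>S\<close> suffices, at a cost of \<open>exp (O (k (ln n)\<^sup>2 / p))\<close>. Edges outside \<open>S\<close> are independent of
  the types, so a fixed colouring of \<open>S\<close> survives with probability \<open>E (1 - p)\<^sup>Q\<close>, where \<open>Q\<close> counts the pairs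
  of vertices outside \<open>S\<close> of equal type. If \<open>2\<^sup>k\<close> is much smaller than \<open>n\<close>, convexity bounds \<open>Q\<close> from
  below. Otherwise one uses that the types are independent and identically distributed, and that two of them
  agree with probability \<open>\<Prod>i. s_val p a\<^sub>i \<ge> s\<^sup>k\<close>, where \<open>a\<^sub>i\<close> is the number of vertices of \<open>S\<close> of colour \<open>i\<close>.
\<close>

subsection \<open>Independent blocks of a product distribution\<close>

text \<open>The product measure over \<open>A\<close> is the product of those over \<open>B\<close>
  and \<open>A - B\<close>; \<open>g\<close> factors through the first and \<open>h\<close> through
  the second.\<close>

lemma Pi_pmf_pair_indep:
  assumes "finite A" "B \<subseteq> A"
    and g: "\<And>f f'. (\<And>x. x \<in> B \<Longrightarrow> f x = f' x) \<Longrightarrow> g f = g f'"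
    and h: "\<And>f f'. (\<And>x. x \<in> A - B \<Longrightarrow> f x = f' x) \<Longrightarrow> h f = h f'"
  shows "map_pmf (\<lambda>f. (g f, h f)) (Pi_pmf A d P) =
         pair_pmf (map_pmf g (Pi_pmf A d P)) (map_pmf h (Pi_pmf A d P))"
proof -
  define X where "X = Pi_pmf B d P"
  define Y where "Y = Pi_pmf (A - B) d P"
  have fin: "finite B" "finite (A - B)"
    using assms(1,2) finite_subset by auto
  have A: "Pi_pmf A d P = map_pmf (\<lambda>(f, g) x. if x \<in> B then f x else g x) (pair_pmf X Y)"
    using Pi_pmf_union[OF fin, of d P] assms(2) by (simp add: X_def Y_def Un_absorb1)
  have g': "g (\<lambda>x. if x \<in> B then f x else f' x) = g f" for f f'
    by (rule g) simp
  have h': "h (\<lambda>x. if x \<in> B then f x else f' x) = h f'" for f f'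
    by (rule h) simp
  have "map_pmf g (Pi_pmf A d P) = map_pmf g (map_pmf fst (pair_pmf X Y))"
    unfolding A pmf.map_comp by (intro map_pmf_cong refl) (auto simp: g')
  moreover have "map_pmf h (Pi_pmf A d P) = map_pmf h (map_pmf snd (pair_pmf X Y))"
    unfolding A pmf.map_comp by (intro map_pmf_cong refl) (auto simp: h')
  moreover have "map_pmf (\<lambda>f. (g f, h f)) (Pi_pmf A d P) = map_pmf (\<lambda>(a, b). (g a, h b)) (pair_pmf X Y)"
    unfolding A pmf.map_comp by (intro map_pmf_cong refl) (auto simp: g' h')
  ultimately show ?thesis
    by (simp add: map_pair map_fst_pair_pmf map_snd_pair_pmf)
qed

text \<open>Induction on the index set: the block of a new index \<open>j\<close> is disjoint from
  the earlier ones, so the earlier outputs depend only on coordinates in \<open>A - B j\<close> and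
  \<open>Pi_pmf_pair_indep\<close> splits off \<open>g j\<close>. The value \<open>d'\<close>
  outside \<open>J\<close> makes the image literally a \<open>Pi_pmf\<close>.\<close>

lemma Pi_pmf_blocks:
  assumes "finite J" "finite A" "\<And>j. j \<in> J \<Longrightarrow> B j \<subseteq> A" "disjoint_family_on B J"
    and "\<And>j f f'. j \<in> J \<Longrightarrow> (\<And>x. x \<in> B j \<Longrightarrow> f x = f' x) \<Longrightarrow> g j f = g j f'"
  shows "map_pmf (\<lambda>f j. if j \<in> J then g j f else d') (Pi_pmf A d P) =
         Pi_pmf J d' (\<lambda>j. map_pmf (g j) (Pi_pmf A d P))"
  using assms(1,3-)
proof (induction J)
  case empty
  then show ?case by (simp add: map_pmf_const)
next
  case (insert j J)
  define h where "h = (\<lambda>f i. if i \<in> J then g i f else d')"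
  have eq: "(\<lambda>f i. if i \<in> insert j J then g i f else d') = (\<lambda>(y, f). f(j := y)) \<circ> (\<lambda>f. (g j f, h f))"
    using insert.hyps(2) by (auto simp: h_def fun_eq_iff)
  have "map_pmf (\<lambda>f i. if i \<in> insert j J then g i f else d') (Pi_pmf A d P) =
        map_pmf (\<lambda>(y, f). f(j := y)) (map_pmf (\<lambda>f. (g j f, h f)) (Pi_pmf A d P))"
    unfolding eq by (simp only: pmf.map_comp)
  also have "map_pmf (\<lambda>f. (g j f, h f)) (Pi_pmf A d P) =
      pair_pmf (map_pmf (g j) (Pi_pmf A d P)) (map_pmf h (Pi_pmf A d P))"
  proof (rule Pi_pmf_pair_indep)
    show "B j \<subseteq> A" using insert.prems by simp
    show "g j f = g j f'" if "\<And>x. x \<in> B j \<Longrightarrow> f x = f' x" for f f'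
      using that insert.prems(3) by blast
    show "h f = h f'" if *: "\<And>x. x \<in> A - B j \<Longrightarrow> f x = f' x" for f f'
    proof -
      have "g i f = g i f'" if "i \<in> J" for i
      proof (rule insert.prems(3))
        show "i \<in> insert j J" using that by simp
        fix x assume "x \<in> B i"
        moreover have "B i \<inter> B j = {}"
          using insert.prems(2) insert.hyps(2) that by (auto simp: disjoint_family_on_def)
        ultimately show "f x = f' x" using * insert.prems(1)[of i] that by auto
      qed
      then show ?thesis by (auto simp: h_def fun_eq_iff)
    qed
  qed (rule assms(2))
  also have "map_pmf h (Pi_pmf A d P) = Pi_pmf J d' (\<lambda>j. map_pmf (g j) (Pi_pmf A d P))"
    unfolding h_def
  proof (rule insert.IH)
    show "disjoint_family_on B J"
      using insert.prems(2) by (auto simp: disjoint_family_on_def)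
    show "B i \<subseteq> A" if "i \<in> J" for i
      using insert.prems(1) that by blast
    show "g i f = g i f'" if "i \<in> J" "\<And>x. x \<in> B i \<Longrightarrow> f x = f' x" for i f f'
      using insert.prems(3)[of i f f'] that by blast
  qed
  finally show ?case
    unfolding Pi_pmf_insert[OF insert.hyps] .
qed

lemma prob_pair_pmf:
  "measure_pmf.prob (pair_pmf X Y) {(x, y). R x y} =
   measure_pmf.expectation Y (\<lambda>y. measure_pmf.prob X {x. R x y})"
proof -
  have pair: "pair_pmf X Y = bind_pmf Y (\<lambda>y. map_pmf (\<lambda>x. (x, y)) X)"
    unfolding pair_pmf_def map_pmf_def by (rule bind_commute_pmf)
  have "emeasure (pair_pmf X Y) {(x, y). R x y} =
      (\<integral>\<^sup>+y. emeasure (measure_pmf X) {x. R x y} \<partial>Y)"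
    unfolding pair emeasure_bind_pmf by (simp add: vimage_def)
  then have "ennreal (measure_pmf.prob (pair_pmf X Y) {(x, y). R x y}) =
      (\<integral>\<^sup>+y. ennreal (measure_pmf.prob X {x. R x y}) \<partial>Y)"
    by (simp add: measure_pmf.emeasure_eq_measure)
  also have "\<dots> = ennreal (measure_pmf.expectation Y (\<lambda>y. measure_pmf.prob X {x. R x y}))"
    by (intro nn_integral_eq_integral measure_pmf.integrable_const_bound[of _ 1]) auto
  finally show ?thesis
    by (subst (asm) ennreal_inj) (auto intro!: Bochner_Integration.integral_nonneg)
qed

lemma prob_all_False_Pi_bernoulli:
  assumes "finite A" "B \<subseteq> A" "0 \<le> p" "p \<le> 1"
  shows "measure_pmf.prob (Pi_pmf A False (\<lambda>_. bernoulli_pmf p)) {f. \<forall>x\<in>B. \<not> f x} = (1 - p) ^ card B"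
proof -
  have "{f. \<forall>x\<in>B. \<not> f x} = Pi A (\<lambda>x. if x \<in> B then {False} else UNIV)"
    using assms(2) by (auto simp: Pi_def split: if_splits)
  then have "measure_pmf.prob (Pi_pmf A False (\<lambda>_. bernoulli_pmf p)) {f. \<forall>x\<in>B. \<not> f x} =
      (\<Prod>x\<in>A. measure_pmf.prob (bernoulli_pmf p) (if x \<in> B then {False} else UNIV))"
    using measure_Pi_pmf_Pi[OF assms(1), where B = "\<lambda>x. if x \<in> B then {False} else UNIV"
        and p = "\<lambda>_. bernoulli_pmf p" and dflt = False] by simp
  also have "\<dots> = (\<Prod>x\<in>A. if x \<in> B then 1 - p else 1)"
    using assms by (intro prod.cong) (auto simp: measure_pmf_single)
  also have "\<dots> = (1 - p) ^ card B"
    using assms by (simp add: prod.If_cases Int_absorb1)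
  finally show ?thesis .
qed

lemma prob_not_pmf: "measure_pmf.prob D {x. \<not> P x} = 1 - measure_pmf.prob D {x. P x}"
  using measure_pmf.prob_compl[of "{x. P x}" D]
  by (simp add: Compl_eq_Diff_UNIV[symmetric] Collect_neg_eq)

text \<open>The hypothesis concerns failure because \<open>prob_all_False_Pi_bernoulli\<close>
  computes the probability that a whole set of edges is absent.\<close>

lemma map_pmf_bool:
  fixes D :: "'a pmf"
  assumes "measure_pmf.prob D {x. \<not> g x} = 1 - r" "0 \<le> r" "r \<le> 1"
  shows "map_pmf g D = bernoulli_pmf r"
proof (rule pmf_eqI)
  have *: "measure_pmf.prob D {x. g x} = r"
    using prob_not_pmf[of D g] assms(1) by simp
  fix b show "pmf (map_pmf g D) b = pmf (bernoulli_pmf r) b"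
    using assms * by (cases b) (auto simp: pmf_map vimage_def)
qed

subsection \<open>Types of vertices\<close>

lemma finite_pairs [simp]: "finite V \<Longrightarrow> finite (pairs V)"
  by (rule finite_subset[of _ "Pow V"]) (auto simp: pairs_def)

lemma card_pairs: "finite V \<Longrightarrow> card (pairs V) = card V choose 2"
  unfolding pairs_def by (rule n_subsets)

lemma two_pairs: "finite V \<Longrightarrow> 2 * card (pairs V) + card V = card V ^ 2"
  by (cases "card V")
    (simp_all add: card_pairs choose_two power2_eq_square del: One_nat_def)

lemma doubleton_in_pairs [simp]: "{u, v} \<in> pairs V \<longleftrightarrow> u \<in> V \<and> v \<in> V \<and> u \<noteq> v"
  by (auto simp: pairs_def card_2_iff)

text \<open>The randomness behind \<open>random_graph\<close>, over any vertex set, so that the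
  pairs inside a subset \<open>W\<close> again have law \<open>edge_pmf W p\<close>.\<close>

definition edge_pmf :: "nat set \<Rightarrow> real \<Rightarrow> (nat set \<Rightarrow> bool) pmf" where
  "edge_pmf V p = Pi_pmf (pairs V) False (\<lambda>_. bernoulli_pmf p)"

text \<open>A type is encoded as an indicator function that is False outside \<open>{1..k}\<close>,
  which makes its law a \<open>Pi_pmf\<close> with default False.\<close>

definition colour_type ::
  "nat set \<Rightarrow> (nat \<Rightarrow> nat) \<Rightarrow> nat \<Rightarrow> (nat set \<Rightarrow> bool) \<Rightarrow> nat \<Rightarrow> nat \<Rightarrow> bool" where
  "colour_type S c k b u = (\<lambda>i. if i \<in> {1..k} then \<exists>x\<in>S. c x = i \<and> b {u, x} else False)"

definition type_pmf :: "real \<Rightarrow> nat set \<Rightarrow> (nat \<Rightarrow> nat) \<Rightarrow> nat \<Rightarrow> (nat \<Rightarrow> bool) pmf" where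
  "type_pmf p S c k =
     Pi_pmf {1..k} False (\<lambda>i. bernoulli_pmf (1 - (1 - p) ^ card {x \<in> S. c x = i}))"

lemma finite_set_type_pmf: "finite (set_pmf (type_pmf p S c k))"
  unfolding type_pmf_def by (subst set_Pi_pmf) auto

text \<open>The edges from \<open>u\<close> to different colour classes of \<open>S\<close> form
  disjoint blocks, so the coordinates of the type are independent; a colour is missed exactly when
  its whole block is absent.\<close>

lemma map_colour_type:
  assumes "finite V" "S \<subseteq> V" "u \<in> V - S" "0 \<le> p" "p \<le> 1"
  shows "map_pmf (\<lambda>b. colour_type S c k b u) (edge_pmf V p) = type_pmf p S c k"
proof -
  define B where "B = (\<lambda>i. (\<lambda>x. {u, x}) ` {x \<in> S. c x = i})"
  have card_B: "card (B i) = card {x \<in> S. c x = i}" for i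
    unfolding B_def by (rule card_image) (auto simp: inj_on_def doubleton_eq_iff)
  have sub: "B i \<subseteq> pairs V" for i
    using assms by (auto simp: B_def)
  have "map_pmf (\<lambda>b. colour_type S c k b u) (edge_pmf V p) =
      Pi_pmf {1..k} False (\<lambda>i. map_pmf (\<lambda>b. \<exists>x\<in>S. c x = i \<and> b {u, x}) (edge_pmf V p))"
    unfolding colour_type_def edge_pmf_def
  proof (rule Pi_pmf_blocks)
    show "disjoint_family_on B {1..k}"
      using assms by (auto simp: disjoint_family_on_def B_def doubleton_eq_iff)
    show "(\<exists>x\<in>S. c x = i \<and> f {u, x}) = (\<exists>x\<in>S. c x = i \<and> f' {u, x})"
      if "\<And>x. x \<in> B i \<Longrightarrow> f x = f' x" for i f f'
      using that by (auto simp: B_def)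
  qed (use assms sub in auto)
  also have "\<dots> = type_pmf p S c k"
    unfolding type_pmf_def
  proof (rule Pi_pmf_cong)
    fix i
    show "map_pmf (\<lambda>b. \<exists>x\<in>S. c x = i \<and> b {u, x}) (edge_pmf V p) =
        bernoulli_pmf (1 - (1 - p) ^ card {x \<in> S. c x = i})"
    proof (rule map_pmf_bool)
      have "{b. \<not> (\<exists>x\<in>S. c x = i \<and> b {u, x})} = {b. \<forall>e\<in>B i. \<not> b e}"
        by (auto simp: B_def)
      then show "measure_pmf.prob (edge_pmf V p) {b. \<not> (\<exists>x\<in>S. c x = i \<and> b {u, x})} =
          1 - (1 - (1 - p) ^ card {x \<in> S. c x = i})"
        using prob_all_False_Pi_bernoulli[OF _ sub] assms by (simp add: edge_pmf_def card_B)
    qed (use assms in \<open>auto simp: power_le_one\<close>)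
  qed auto
  finally show ?thesis .
qed

text \<open>The left side is the probability that two independent types agree. It factorises over
  the colours, and a coordinate that is True with probability r agrees with probability r^2 + (1 -
  r)^2.\<close>

lemma type_pmf_collision:
  assumes "0 \<le> p" "p \<le> 1"
  shows "measure_pmf.expectation (type_pmf p S c k) (pmf (type_pmf p S c k)) =
         (\<Prod>i\<in>{1..k}. s_val p (card {x \<in> S. c x = i}))"
proof -
  define r where "r = (\<lambda>i. 1 - (1 - p) ^ card {x \<in> S. c x = i})"
  have r: "0 \<le> r i" "r i \<le> 1" for i
    using assms by (auto simp: r_def power_le_one)
  have T: "type_pmf p S c k = Pi_pmf {1..k} False (\<lambda>i. bernoulli_pmf (r i))"
    by (simp add: type_pmf_def r_def)
  have "measure_pmf.expectation (type_pmf p S c k) (pmf (type_pmf p S c k)) =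
      measure_pmf.expectation (type_pmf p S c k) (\<lambda>t. \<Prod>i\<in>{1..k}. pmf (bernoulli_pmf (r i)) (t i))"
  proof (intro integral_cong_AE AE_pmfI)
    \<comment> \<open>The product formula for \<open>pmf\<close> holds only at functions with the
      default value outside \<open>{1..k}\<close>, hence the restriction to the support.\<close>
    fix t assume "t \<in> set_pmf (type_pmf p S c k)"
    then have "\<forall>x. x \<notin> {1..k} \<longrightarrow> t x = False"
      using set_Pi_pmf_subset[of "{1..k}" False "\<lambda>i. bernoulli_pmf (r i)"] unfolding T by blast
    then show "pmf (type_pmf p S c k) t = (\<Prod>i\<in>{1..k}. pmf (bernoulli_pmf (r i)) (t i))"
      unfolding T by (subst pmf_Pi') auto
  qed auto
  also have "\<dots> = (\<Prod>i\<in>{1..k}. measure_pmf.expectation (bernoulli_pmf (r i)) (pmf (bernoulli_pmf (r i))))"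
    unfolding T by (rule expectation_prod_Pi_pmf) (auto intro: measure_pmf.integrable_const_bound[of _ 1] simp: pmf_le_1)
  also have "\<dots> = (\<Prod>i\<in>{1..k}. s_val p (card {x \<in> S. c x = i}))"
    using r by (intro prod.cong refl) (auto simp: s_val_def r_def power2_eq_square algebra_simps)
  finally show ?thesis .
qed

lemma prob_eq_pair_pmf:
  "measure_pmf.prob (pair_pmf X X) {(x, y). x = y} = measure_pmf.expectation X (pmf X)"
  unfolding prob_pair_pmf by (simp add: measure_pmf_single)

lemma colour_type_cong:
  "(\<And>x. x \<in> S \<Longrightarrow> f {u, x} = f' {u, x}) \<Longrightarrow> colour_type S c k f u = colour_type S c k f' u"
  by (auto simp: colour_type_def fun_eq_iff)

text \<open>Since \<open>S\<close> avoids \<open>u\<close> and \<open>v\<close>, the pair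
  \<open>{u, v}\<close>, the star from \<open>u\<close> to \<open>S\<close> and the star from
  \<open>v\<close> to \<open>S\<close> are disjoint and hence independent. The product is the
  collision probability of two independent types.\<close>

lemma prob_edge_same_type:
  assumes "finite V" "S \<subseteq> V - {u, v}" "u \<in> V" "v \<in> V" "u \<noteq> v" "0 \<le> p" "p \<le> 1"
  shows "measure_pmf.prob (edge_pmf V p) {b. b {u, v} \<and> colour_type S c k b u = colour_type S c k b v} =
         p * (\<Prod>i\<in>{1..k}. s_val p (card {x \<in> S. c x = i}))"
proof -
  let ?D = "edge_pmf V p" and ?T = "\<lambda>b. colour_type S c k b"
  have fin: "finite (pairs V)" using assms by simp
  have S: "u \<notin> S" "v \<notin> S" "S \<subseteq> V" using assms by auto
  \<comment> \<open>First split: the star of \<open>u\<close> against everything else, which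
    contains the star of \<open>v\<close>.\<close>
  have uv: "map_pmf (\<lambda>b. (?T b u, ?T b v)) ?D = pair_pmf (type_pmf p S c k) (type_pmf p S c k)"
  proof -
    have "map_pmf (\<lambda>b. (?T b u, ?T b v)) ?D = pair_pmf (map_pmf (\<lambda>b. ?T b u) ?D) (map_pmf (\<lambda>b. ?T b v) ?D)"
      unfolding edge_pmf_def
    proof (rule Pi_pmf_pair_indep[OF fin])
      show "(\<lambda>x. {u, x}) ` S \<subseteq> pairs V"
        using assms by auto
      show "?T f u = ?T f' u" if "\<And>x. x \<in> (\<lambda>x. {u, x}) ` S \<Longrightarrow> f x = f' x" for f f'
        using that by (intro colour_type_cong) auto
      show "?T f v = ?T f' v" if "\<And>x. x \<in> pairs V - (\<lambda>x. {u, x}) ` S \<Longrightarrow> f x = f' x" for f f'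
        by (intro colour_type_cong that) (use assms in \<open>auto simp: doubleton_eq_iff\<close>)
    qed
    then show ?thesis
      using assms S by (simp add: map_colour_type)
  qed
  \<comment> \<open>Second split: the single pair \<open>{u, v}\<close> against both stars.\<close>
  have "map_pmf (\<lambda>b. (b {u, v}, ?T b u = ?T b v)) ?D =
      pair_pmf (map_pmf (\<lambda>b. b {u, v}) ?D) (map_pmf (\<lambda>b. ?T b u = ?T b v) ?D)"
    unfolding edge_pmf_def
  proof (rule Pi_pmf_pair_indep[OF fin])
    show "{{u, v}} \<subseteq> pairs V" using assms by auto
    show "(?T f u = ?T f v) = (?T f' u = ?T f' v)" if "\<And>x. x \<in> pairs V - {{u, v}} \<Longrightarrow> f x = f' x" for f f'
    proof -
      have "?T f u = ?T f' u" "?T f v = ?T f' v"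
        by (intro colour_type_cong that; use assms in \<open>auto simp: doubleton_eq_iff\<close>)+
      then show ?thesis by simp
    qed
    show "f {u, v} = f' {u, v}" if "\<And>x. x \<in> {{u, v}} \<Longrightarrow> f x = f' x" for f f' :: "nat set \<Rightarrow> bool"
      using that by blast
  qed
  moreover have "measure_pmf.prob ?D {b. b {u, v} \<and> ?T b u = ?T b v} =
      measure_pmf.prob (map_pmf (\<lambda>b. (b {u, v}, ?T b u = ?T b v)) ?D) ({True} \<times> {True})"
    by (simp add: vimage_def)
  ultimately have "measure_pmf.prob ?D {b. b {u, v} \<and> ?T b u = ?T b v} =
      measure_pmf.prob (map_pmf (\<lambda>b. b {u, v}) ?D) {True} *
      measure_pmf.prob (map_pmf (\<lambda>b. ?T b u = ?T b v) ?D) {True}"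
    by (simp only: measure_pmf_prob_product countable_finite finite.intros)
  also have "map_pmf (\<lambda>b. b {u, v}) ?D = bernoulli_pmf p"
    unfolding edge_pmf_def Pi_pmf_component[OF fin] using assms by simp
  also have "measure_pmf.prob (bernoulli_pmf p) {True} = p"
    using assms by (simp add: measure_pmf_single)
  also have "measure_pmf.prob (map_pmf (\<lambda>b. ?T b u = ?T b v) ?D) {True} =
      measure_pmf.prob (map_pmf (\<lambda>b. (?T b u, ?T b v)) ?D) {(x, y). x = y}"
    by (simp add: vimage_def)
  also have "\<dots> = (\<Prod>i\<in>{1..k}. s_val p (card {x \<in> S. c x = i}))"
    unfolding uv prob_eq_pair_pmf using assms by (simp add: type_pmf_collision)
  finally show ?thesis .
qed

definition mono_pairs :: "nat set \<Rightarrow> (nat \<Rightarrow> 'a) \<Rightarrow> nat set set" where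
  "mono_pairs W \<tau> = {e \<in> pairs W. \<forall>u\<in>e. \<forall>v\<in>e. \<tau> u = \<tau> v}"

lemma mono_pairs_cong: "(\<And>u. u \<in> W \<Longrightarrow> \<tau> u = \<tau>' u) \<Longrightarrow> mono_pairs W \<tau> = mono_pairs W \<tau>'"
proof -
  assume *: "\<And>u. u \<in> W \<Longrightarrow> \<tau> u = \<tau>' u"
  have "(\<forall>u\<in>e. \<forall>v\<in>e. \<tau> u = \<tau> v) \<longleftrightarrow> (\<forall>u\<in>e. \<forall>v\<in>e. \<tau>' u = \<tau>' v)" if "e \<in> pairs W" for e
    by (intro ball_cong refl arg_cong2[where f = "(=)"] *) (use that in \<open>auto simp: pairs_def\<close>)
  then show ?thesis
    unfolding mono_pairs_def by blast
qed

text \<open>The types of the vertices of \<open>W\<close> depend only on pairs between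
  \<open>W\<close> and \<open>S\<close>, in disjoint stars, so they are independent and identically
  distributed, and they are independent of the pairs inside \<open>W\<close>. Given the types,
  \<open>mono_pairs\<close> is a fixed set and each of its members is a non-edge with probability
  \<open>1 - p\<close>.\<close>

lemma prob_no_mono_edge:
  assumes "finite V" "S \<subseteq> V" "W = V - S" "0 \<le> p" "p \<le> 1"
  shows "measure_pmf.prob (edge_pmf V p) {b. \<forall>e\<in>mono_pairs W (colour_type S c k b). \<not> b e} =
         measure_pmf.expectation (Pi_pmf W (\<lambda>_. False) (\<lambda>_. type_pmf p S c k))
           (\<lambda>\<tau>. (1 - p) ^ card (mono_pairs W \<tau>))"
proof -
  let ?D = "edge_pmf V p"
  define g where "g = (\<lambda>b e. if e \<in> pairs W then b e else False)"
  define h where "h = (\<lambda>b u. if u \<in> W then colour_type S c k b u else (\<lambda>_. False))"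
  have fin: "finite (pairs V)" "finite W" "finite (pairs W)" and sub: "pairs W \<subseteq> pairs V"
    using assms by (auto simp: pairs_def)
  have h: "map_pmf h ?D = Pi_pmf W (\<lambda>_. False) (\<lambda>_. type_pmf p S c k)"
  proof -
    have "map_pmf h ?D = Pi_pmf W (\<lambda>_. False) (\<lambda>u. map_pmf (\<lambda>b. colour_type S c k b u) ?D)"
      unfolding h_def edge_pmf_def
    proof (rule Pi_pmf_blocks[OF fin(2,1)])
      show "(\<lambda>x. {u, x}) ` S \<subseteq> pairs V" if "u \<in> W" for u
        using that assms by auto
      show "disjoint_family_on (\<lambda>u. (\<lambda>x. {u, x}) ` S) W"
        using assms by (auto simp: disjoint_family_on_def doubleton_eq_iff)
      show "colour_type S c k f u = colour_type S c k f' u"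
        if "\<And>x. x \<in> (\<lambda>x. {u, x}) ` S \<Longrightarrow> f x = f' x" for u f f'
        using that by (intro colour_type_cong) auto
    qed
    also have "\<dots> = Pi_pmf W (\<lambda>_. False) (\<lambda>_. type_pmf p S c k)"
      using assms by (intro Pi_pmf_cong refl map_colour_type) auto
    finally show ?thesis .
  qed
  have gh: "map_pmf (\<lambda>b. (g b, h b)) ?D = pair_pmf (map_pmf g ?D) (map_pmf h ?D)"
    unfolding edge_pmf_def
  proof (rule Pi_pmf_pair_indep[OF fin(1) sub])
    show "g f = g f'" if "\<And>x. x \<in> pairs W \<Longrightarrow> f x = f' x" for f f'
      using that by (auto simp: g_def fun_eq_iff)
    show "h f = h f'" if *: "\<And>x. x \<in> pairs V - pairs W \<Longrightarrow> f x = f' x" for f f'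
    proof -
      have "colour_type S c k f u = colour_type S c k f' u" if "u \<in> W" for u
        by (intro colour_type_cong *) (use that assms in auto)
      then show ?thesis unfolding h_def by (intro ext) (metis (full_types))
    qed
  qed
  have g: "map_pmf g ?D = edge_pmf W p"
    unfolding edge_pmf_def g_def by (rule Pi_pmf_subset[OF fin(1) sub, symmetric])
  have m: "mono_pairs W (colour_type S c k b) = mono_pairs W (h b)" for b
    by (rule mono_pairs_cong) (simp only: h_def if_True)
  have "measure_pmf.prob ?D {b. \<forall>e\<in>mono_pairs W (colour_type S c k b). \<not> b e} =
      measure_pmf.prob (map_pmf (\<lambda>b. (g b, h b)) ?D) {(x, y). \<forall>e\<in>mono_pairs W y. \<not> x e}"
    unfolding m measure_map_pmf
    by (intro arg_cong[where f = "measure_pmf.prob _"]) (auto simp: g_def mono_pairs_def)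
  also have "\<dots> = measure_pmf.expectation (Pi_pmf W (\<lambda>_. False) (\<lambda>_. type_pmf p S c k))
      (\<lambda>\<tau>. measure_pmf.prob (edge_pmf W p) {x. \<forall>e\<in>mono_pairs W \<tau>. \<not> x e})"
    unfolding gh g h by (rule prob_pair_pmf)
  also have "\<dots> = measure_pmf.expectation (Pi_pmf W (\<lambda>_. False) (\<lambda>_. type_pmf p S c k))
           (\<lambda>\<tau>. (1 - p) ^ card (mono_pairs W \<tau>))"
  proof -
    have "measure_pmf.prob (edge_pmf W p) {x. \<forall>e\<in>mono_pairs W \<tau>. \<not> x e} = (1 - p) ^ card (mono_pairs W \<tau>)"
      for \<tau> :: "nat \<Rightarrow> nat \<Rightarrow> bool"
      unfolding edge_pmf_def
      by (rule prob_all_False_Pi_bernoulli[OF fin(3) _ assms(4,5)]) (simp add: mono_pairs_def)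
    then show ?thesis by simp
  qed
  finally show ?thesis .
qed

subsection \<open>Pairs of equal type\<close>

lemma mono_pairs_eq_Union:
  "mono_pairs W \<tau> = (\<Union>t\<in>\<tau> ` W. pairs {u \<in> W. \<tau> u = t})"
proof (intro equalityI subsetI)
  fix e assume e: "e \<in> mono_pairs W \<tau>"
  then have "e \<noteq> {}" by (force simp: mono_pairs_def pairs_def)
  then obtain u where u: "u \<in> e" by blast
  have "e \<subseteq> W" "card e = 2" "\<forall>v\<in>e. \<tau> v = \<tau> u"
    using e u unfolding mono_pairs_def pairs_def by blast+
  with u have "\<tau> u \<in> \<tau> ` W" "e \<in> pairs {v \<in> W. \<tau> v = \<tau> u}"
    unfolding pairs_def by blast+
  then show "e \<in> (\<Union>t\<in>\<tau> ` W. pairs {u \<in> W. \<tau> u = t})" by blast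
next
  fix e assume "e \<in> (\<Union>t\<in>\<tau> ` W. pairs {u \<in> W. \<tau> u = t})"
  then obtain t where "e \<subseteq> {u \<in> W. \<tau> u = t}" "card e = 2"
    unfolding pairs_def by blast
  then show "e \<in> mono_pairs W \<tau>"
    unfolding mono_pairs_def pairs_def by blast
qed

lemma pairs_mono_le_card_mono_pairs:
  assumes "finite W" "A \<subseteq> W" "\<And>u. u \<in> A \<Longrightarrow> \<tau> u = t"
  shows "card (pairs A) \<le> card (mono_pairs W \<tau>)"
proof (rule card_mono)
  have "\<tau> u = \<tau> v" if "u \<in> A" "v \<in> A" for u v
    using that assms(3) by metis
  then show "pairs A \<subseteq> mono_pairs W \<tau>"
    using assms(2) unfolding mono_pairs_def pairs_def by blast
qed (use assms(1) in \<open>simp add: mono_pairs_def\<close>)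

text \<open>Pairs of equal type split according to the common type; adding \<open>card W\<close>
  turns each binomial coefficient into a square, ready for Cauchy-Schwarz.\<close>

lemma two_card_mono_pairs:
  assumes "finite W"
  shows "2 * card (mono_pairs W \<tau>) + card W = (\<Sum>t\<in>\<tau> ` W. card {u \<in> W. \<tau> u = t} ^ 2)"
proof -
  have "card (mono_pairs W \<tau>) = (\<Sum>t\<in>\<tau> ` W. card (pairs {u \<in> W. \<tau> u = t}))"
    unfolding mono_pairs_eq_Union
  proof (rule card_UN_disjoint)
    show "\<forall>s\<in>\<tau> ` W. \<forall>t\<in>\<tau> ` W. s \<noteq> t \<longrightarrow>
        pairs {u \<in> W. \<tau> u = s} \<inter> pairs {u \<in> W. \<tau> u = t} = {}"
      by (auto simp: pairs_def card_2_iff)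
  qed (use assms in auto)
  moreover have "card W = (\<Sum>t\<in>\<tau> ` W. card {u \<in> W. \<tau> u = t})"
    using sum.image_gen[OF assms, of "\<lambda>_. 1::nat" \<tau>] by simp
  ultimately have "2 * card (mono_pairs W \<tau>) + card W =
      (\<Sum>t\<in>\<tau> ` W. 2 * card (pairs {u \<in> W. \<tau> u = t}) + card {u \<in> W. \<tau> u = t})"
    by (simp add: sum.distrib sum_distrib_left)
  also have "\<dots> = (\<Sum>t\<in>\<tau> ` W. card {u \<in> W. \<tau> u = t} ^ 2)"
    using assms by (intro sum.cong refl two_pairs) auto
  finally show ?thesis .
qed

text \<open>Cauchy-Schwarz over the type classes gives w^2 \<le> (2 Q + w) N with w =
  \<open>card W\<close>; the diagonal contribution w N is at most w^2 / 2 because 2 N \<le>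
  w.\<close>

lemma card_mono_pairs_ge_of_few_types:
  assumes "finite W" "\<tau> ` W \<subseteq> X" "finite X" "real (card X) \<le> N" "0 < N" "2 * N \<le> real (card W)"
  shows "real (card W) ^ 2 / (4 * N) \<le> real (card (mono_pairs W \<tau>))"
proof -
  define w where "w = real (card W)"
  define Q where "Q = real (card (mono_pairs W \<tau>))"
  have c: "real (card (\<tau> ` W)) \<le> N"
    using card_mono[OF assms(3,2)] assms(4) by linarith
  have "w = (\<Sum>t\<in>\<tau> ` W. real (card {u \<in> W. \<tau> u = t}))"
    using sum.image_gen[OF assms(1), of "\<lambda>_. 1::real" \<tau>] by (simp add: w_def)
  then have "w ^ 2 \<le> (\<Sum>t\<in>\<tau> ` W. (real (card {u \<in> W. \<tau> u = t}))^2) * real (card (\<tau> ` W))"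
    using sum_squared_le_sum_of_squares[of "\<lambda>t. real (card {u \<in> W. \<tau> u = t})" "\<tau> ` W"] assms(1) by simp
  also have "(\<Sum>t\<in>\<tau> ` W. (real (card {u \<in> W. \<tau> u = t}))^2) = 2 * Q + w"
    using arg_cong[OF two_card_mono_pairs[OF assms(1), of \<tau>], of real] by (simp add: w_def Q_def)
  also have "(2 * Q + w) * real (card (\<tau> ` W)) \<le> (2 * Q + w) * N"
    by (rule mult_left_mono[OF c]) (simp add: Q_def w_def)
  finally have *: "w ^ 2 \<le> (2 * Q + w) * N" .
  have "w * N * 2 \<le> w * w"
    using mult_left_mono[OF assms(6), of w] by (simp add: w_def algebra_simps)
  with * have "w ^ 2 \<le> 4 * N * Q"
    by (simp add: power2_eq_square algebra_simps)
  then show ?thesis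
    using assms(5) by (simp add: w_def Q_def field_simps)
qed

text \<open>Only pairs with one end in \<open>A\<close> and one in \<open>B\<close> are counted;
  disjointness makes each of them arise once.\<close>

lemma sum_card_same_le_card_mono_pairs:
  assumes "finite A" "finite B" "A \<inter> B = {}"
  shows "(\<Sum>b\<in>B. card {a \<in> A. \<tau> a = \<tau> b}) \<le> card (mono_pairs (A \<union> B) \<tau>)"
proof -
  have "(\<Sum>b\<in>B. card {a \<in> A. \<tau> a = \<tau> b}) = card (SIGMA b:B. {a \<in> A. \<tau> a = \<tau> b})"
    using assms by (subst card_SigmaI) auto
  also have "\<dots> = card ((\<lambda>(b, a). {a, b}) ` (SIGMA b:B. {a \<in> A. \<tau> a = \<tau> b}))"
    using assms(3) by (intro card_image[symmetric]) (auto simp: inj_on_def doubleton_eq_iff)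
  also have "\<dots> \<le> card (mono_pairs (A \<union> B) \<tau>)"
    using assms by (intro card_mono) (auto simp: mono_pairs_def)
  finally show ?thesis .
qed

section \<open>Exponential moments of the number of pairs of equal type\<close>

lemma expectation_pair_pmf:
  fixes f :: "'a \<times> 'b \<Rightarrow> real"
  assumes "finite (set_pmf X)" "finite (set_pmf Y)"
  shows "measure_pmf.expectation (pair_pmf X Y) f =
         measure_pmf.expectation X (\<lambda>x. measure_pmf.expectation Y (\<lambda>y. f (x, y)))"
proof -
  have "measure_pmf.expectation (pair_pmf X Y) f =
      (\<Sum>x\<in>set_pmf X. pmf X x *\<^sub>R measure_pmf.expectation (bind_pmf Y (\<lambda>y. return_pmf (x, y))) f)"
    unfolding pair_pmf_def using assms by (intro pmf_expectation_bind) auto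
  also have "\<dots> = (\<Sum>x\<in>set_pmf X. pmf X x *\<^sub>R measure_pmf.expectation Y (\<lambda>y. f (x, y)))"
    by (simp add: map_pmf_def[symmetric])
  also have "\<dots> = measure_pmf.expectation X (\<lambda>x. measure_pmf.expectation Y (\<lambda>y. f (x, y)))"
    using assms(1) by (subst integral_measure_pmf[of "set_pmf X"]) auto
  finally show ?thesis .
qed

lemma finite_set_Pi_pmf:
  assumes "finite A" "\<And>x. x \<in> A \<Longrightarrow> finite (set_pmf (P x))"
  shows "finite (set_pmf (Pi_pmf A d P))"
  unfolding set_Pi_pmf[OF assms(1)] using assms by auto

lemma pmf_expectation_mono:
  fixes f g :: "'a \<Rightarrow> real"
  assumes "finite (set_pmf X)" "\<And>x. x \<in> set_pmf X \<Longrightarrow> f x \<le> g x"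
  shows "measure_pmf.expectation X f \<le> measure_pmf.expectation X g"
  using assms by (intro integral_mono_AE integrable_measure_pmf_finite AE_pmfI) auto

lemma one_minus_power_le_exp:
  assumes "0 \<le> p" "p \<le> (1::real)"
  shows "(1 - p) ^ m \<le> exp (- (p * real m))"
proof -
  have "(1 - p) ^ m \<le> exp (- p) ^ m"
    using exp_ge_add_one_self[of "- p"] assms by (intro power_mono) auto
  then show ?thesis by (simp add: exp_of_nat_mult[symmetric] mult.commute)
qed

text \<open>The square of each atom is a summand of \<sigma>, so every atom is at most sqrt \<sigma>
  and y = l * \<open>pmf \<mu> t\<close> lies in [0, 1]. There exp (- y) \<le> 1 / (1 + y) \<le> 1 -
  y / 2, and averaging gives 1 - l \<sigma> / 2.\<close>

lemma expectation_exp_neg_pmf_le: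
  fixes \<mu> :: "'t pmf"
  assumes fin: "finite (set_pmf \<mu>)" and \<sigma>: "\<sigma> = measure_pmf.expectation \<mu> (pmf \<mu>)"
    and "0 \<le> l" "l * sqrt \<sigma> \<le> 1"
  shows "measure_pmf.expectation \<mu> (\<lambda>t. exp (- l * pmf \<mu> t)) \<le> exp (- l * \<sigma> / 2)"
proof -
  note int = integrable_measure_pmf_finite[OF fin]
  have \<sigma>_sum: "\<sigma> = (\<Sum>t\<in>set_pmf \<mu>. pmf \<mu> t * pmf \<mu> t)"
    unfolding \<sigma> using fin by (subst integral_measure_pmf[of "set_pmf \<mu>"]) auto
  have \<sigma>0: "0 \<le> \<sigma>" unfolding \<sigma>_sum by (intro sum_nonneg) auto
  have le: "pmf \<mu> t \<le> sqrt \<sigma>" if "t \<in> set_pmf \<mu>" for t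
  proof (rule real_le_rsqrt)
    show "(pmf \<mu> t)\<^sup>2 \<le> \<sigma>"
      unfolding \<sigma>_sum power2_eq_square using fin that
      by (intro member_le_sum[of t _ "\<lambda>t. pmf \<mu> t * pmf \<mu> t"]) auto
  qed
  have "measure_pmf.expectation \<mu> (\<lambda>t. exp (- l * pmf \<mu> t)) \<le>
      measure_pmf.expectation \<mu> (\<lambda>t. 1 - (l / 2) * pmf \<mu> t)"
  proof (rule pmf_expectation_mono[OF fin])
    fix t assume t: "t \<in> set_pmf \<mu>"
    define y where "y = l * pmf \<mu> t"
    have y: "0 \<le> y" "y \<le> 1"
      using assms(3) mult_left_mono[OF le[OF t] assms(3)] assms(4) by (auto simp: y_def)
    have "1 + y \<le> exp y" by (rule exp_ge_add_one_self)
    then have "exp (- y) \<le> 1 / (1 + y)"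
      using y by (simp add: exp_minus field_simps)
    also have "\<dots> \<le> 1 - y / 2"
    proof -
      have "y * y \<le> y" using mult_left_mono[OF y(2,1)] by simp
      then show ?thesis using y by (simp add: field_simps)
    qed
    finally show "exp (- l * pmf \<mu> t) \<le> 1 - (l / 2) * pmf \<mu> t"
      by (simp add: y_def)
  qed
  also have "\<dots> = 1 - l * \<sigma> / 2"
    unfolding \<sigma> by (subst Bochner_Integration.integral_diff) (auto intro: int)
  also have "\<dots> \<le> exp (- (l * \<sigma> / 2))"
    using exp_ge_add_one_self[of "- (l * \<sigma> / 2)"] by simp
  finally show ?thesis by simp
qed

text \<open>The vertices of \<open>B\<close> are exposed after those of \<open>A\<close>: the number of pairs they close is governed by
  \<open>\<Sum>a\<in>A. pmf \<mu> (\<tau> a)\<close>, unless some type occurs so often on \<open>A\<close> (more than \<open>L / p\<close> times) that the pairs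
  inside \<open>A\<close> suffice.\<close>

lemma expectation_mono_pairs_le:
  fixes \<mu> :: "'t pmf" and p L l :: real
  assumes fin: "finite (set_pmf \<mu>)" "finite A" "finite B" "A \<inter> B = {}"
    and p: "0 < p" "p \<le> 1" and L: "2 \<le> L"
    and \<sigma>: "\<sigma> = measure_pmf.expectation \<mu> (pmf \<mu>)"
    and l: "0 \<le> l" "l \<le> real (card B) * p / (1 + L)" "l * sqrt \<sigma> \<le> 1"
  shows "measure_pmf.expectation (Pi_pmf (A \<union> B) d (\<lambda>_. \<mu>)) (\<lambda>\<tau>. (1 - p) ^ card (mono_pairs (A \<union> B) \<tau>))
         \<le> exp (- (L\<^sup>2 / (4 * p))) + exp (- (real (card A) * l * \<sigma> / 2))"
proof -
  define X where "X = Pi_pmf A d (\<lambda>_. \<mu>)"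
  define Y where "Y = Pi_pmf B d (\<lambda>_. \<mu>)"
  define m where "m = (\<lambda>(f, g) x. if x \<in> A then f x else (g x :: 't))"
  define Q where "Q = (\<lambda>f g. card (mono_pairs (A \<union> B) (m (f, g))))"
  have finX: "finite (set_pmf X)" and finY: "finite (set_pmf Y)"
    unfolding X_def Y_def using fin by (auto intro!: finite_set_Pi_pmf)
  have finAB: "finite (A \<union> B)" using fin by simp
  note int\<mu> = integrable_measure_pmf_finite[OF fin(1)]
  have q: "0 \<le> 1 - p" "1 - p \<le> 1" using p by auto
  have pow: "(1 - p) ^ n \<le> exp (- (p * real n))" for n
    using p by (intro one_minus_power_le_exp) auto
  \<comment> \<open>The types \<open>f\<close> on \<open>A\<close> are fixed and those on
    \<open>B\<close> averaged. Each case below yields one of the two summands; the other is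
    nonnegative.\<close>
  have step: "measure_pmf.expectation Y (\<lambda>g. (1 - p) ^ Q f g) \<le>
      exp (- (L\<^sup>2 / (4 * p))) + (\<Prod>a\<in>A. exp (- l * pmf \<mu> (f a)))" for f
  proof (cases "\<exists>t. real (card {a \<in> A. f a = t}) > L / p")
    case True
    then obtain t where t: "real (card {a \<in> A. f a = t}) > L / p" by blast
    define x where "x = real (card {a \<in> A. f a = t})"
    have x: "x > L / p" using t by (simp add: x_def)
    have "L \<le> L / p" using p L by (simp add: field_simps)
    then have x2: "x \<ge> 2" using x L by linarith
    have "(1 - p) ^ Q f g \<le> exp (- (L\<^sup>2 / (4 * p)))" for g
    proof -
      have "card (pairs {a \<in> A. f a = t}) \<le> Q f g"
        unfolding Q_def by (rule pairs_mono_le_card_mono_pairs[OF finAB]) (auto simp: m_def)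
      moreover have "2 * real (card (pairs {a \<in> A. f a = t})) + x = x ^ 2"
        using arg_cong[OF two_pairs[of "{a \<in> A. f a = t}"], of real] fin by (simp add: x_def)
      \<comment> \<open>For x \<ge> 2 the number (x^2 - x) / 2 of pairs is at least x^2 / 4.\<close>
      moreover have "2 * x \<le> x ^ 2"
        using x2 by (simp add: power2_eq_square)
      ultimately have "x ^ 2 / 4 \<le> real (Q f g)" by linarith
      moreover have "(L / p) ^ 2 \<le> x ^ 2"
        using x p L by (intro power_mono) auto
      ultimately have "(L / p) ^ 2 / 4 \<le> real (Q f g)" by linarith
      then have "p * ((L / p) ^ 2 / 4) \<le> p * real (Q f g)"
        using p by (intro mult_left_mono) auto
      moreover have "p * ((L / p) ^ 2 / 4) = L\<^sup>2 / (4 * p)"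
        using p by (simp add: power2_eq_square field_simps)
      ultimately show ?thesis
        using pow[of "Q f g"] by (smt (verit) exp_le_cancel_iff)
    qed
    then have "measure_pmf.expectation Y (\<lambda>g. (1 - p) ^ Q f g) \<le>
        measure_pmf.expectation Y (\<lambda>_. exp (- (L\<^sup>2 / (4 * p))))"
      by (intro pmf_expectation_mono[OF finY]) auto
    then show ?thesis
      by (simp add: prod_nonneg add_increasing2)
  next
    case False
    define x where "x = (\<lambda>t. card {a \<in> A. f a = t})"
    have x: "p * real (x t) \<le> L" for t
      using False p by (auto simp: x_def not_less field_simps)
    \<comment> \<open>Keeping only the pairs between \<open>A\<close> and \<open>B\<close> makes the
      bound a product over independent vertices of \<open>B\<close>.\<close>
    have "(1 - p) ^ Q f g \<le> (\<Prod>b\<in>B. (1 - p) ^ x (g b))" for g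
    proof -
      have "(\<Sum>b\<in>B. x (g b)) = (\<Sum>b\<in>B. card {a \<in> A. m (f, g) a = m (f, g) b})"
        using fin(4) unfolding x_def m_def
        by (intro sum.cong refl arg_cong[where f = card]) auto
      also have "\<dots> \<le> Q f g"
        unfolding Q_def by (rule sum_card_same_le_card_mono_pairs[OF fin(2-4)])
      finally have "(1 - p) ^ Q f g \<le> (1 - p) ^ (\<Sum>b\<in>B. x (g b))"
        using q by (intro power_decreasing) auto
      then show ?thesis by (simp add: power_sum)
    qed
    then have "measure_pmf.expectation Y (\<lambda>g. (1 - p) ^ Q f g) \<le>
        measure_pmf.expectation Y (\<lambda>g. \<Prod>b\<in>B. (1 - p) ^ x (g b))"
      by (intro pmf_expectation_mono[OF finY])
    also have "\<dots> = (\<Prod>b\<in>B. measure_pmf.expectation \<mu> (\<lambda>t. (1 - p) ^ x t))"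
      unfolding Y_def using fin q by (intro expectation_prod_Pi_pmf int\<mu>) auto
    also have "\<dots> = measure_pmf.expectation \<mu> (\<lambda>t. (1 - p) ^ x t) ^ card B"
      by simp
    also have "measure_pmf.expectation \<mu> (\<lambda>t. (1 - p) ^ x t) \<le>
        exp (- (p / (1 + L) * (\<Sum>a\<in>A. pmf \<mu> (f a))))"
    proof -
      have "measure_pmf.expectation \<mu> (\<lambda>t. (1 - p) ^ x t) \<le>
          measure_pmf.expectation \<mu> (\<lambda>t. 1 - p / (1 + L) * real (x t))"
      proof (rule pmf_expectation_mono[OF fin(1)])
        fix t
        \<comment> \<open>Linearisation: exp (- y) \<le> 1 - y / (1 + y) \<le> 1 - y / (1 + L),
          where y \<le> L because no type occurs more than L / p times on \<open>A\<close>.\<close>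
        define y where "y = p * real (x t)"
        have y: "0 \<le> y" "y \<le> L" using p x[of t] by (auto simp: y_def)
        have "1 + y \<le> exp y" by (rule exp_ge_add_one_self)
        then have "exp (- y) \<le> 1 / (1 + y)"
          using y by (simp add: exp_minus field_simps)
        also have "\<dots> = 1 - y / (1 + y)" using y by (simp add: field_simps)
        also have "\<dots> \<le> 1 - y / (1 + L)" using y by (simp add: frac_le)
        finally show "(1 - p) ^ x t \<le> 1 - p / (1 + L) * real (x t)"
          using pow[of "x t"] by (simp add: y_def)
      qed
      also have "\<dots> = 1 - p / (1 + L) * measure_pmf.expectation \<mu> (\<lambda>t. real (x t))"
        by (subst Bochner_Integration.integral_diff) (auto intro: int\<mu>)
      \<comment> \<open>Writing \<open>x t\<close> as a sum of indicators over \<open>A\<close>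
        turns its mean into the sum of the atoms at the types seen on \<open>A\<close>.\<close>
      also have "measure_pmf.expectation \<mu> (\<lambda>t. real (x t)) =
          measure_pmf.expectation \<mu> (\<lambda>t. \<Sum>a\<in>A. indicator {f a} t)"
        using fin(2) by (intro Bochner_Integration.integral_cong refl)
          (auto simp: x_def indicator_def sum.If_cases Int_def eq_commute)
      also have "\<dots> = (\<Sum>a\<in>A. pmf \<mu> (f a))"
        by (subst Bochner_Integration.integral_sum) (auto intro: int\<mu> simp: measure_pmf_single)
      also have "1 - p / (1 + L) * (\<Sum>a\<in>A. pmf \<mu> (f a)) \<le> exp (- (p / (1 + L) * (\<Sum>a\<in>A. pmf \<mu> (f a))))"
        using exp_ge_add_one_self[of "- (p / (1 + L) * (\<Sum>a\<in>A. pmf \<mu> (f a)))"] by simp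
      finally show ?thesis .
    qed
    then have "measure_pmf.expectation \<mu> (\<lambda>t. (1 - p) ^ x t) ^ card B \<le>
        exp (- (p / (1 + L) * (\<Sum>a\<in>A. pmf \<mu> (f a)))) ^ card B"
      using q by (intro power_mono Bochner_Integration.integral_nonneg) auto
    also have "\<dots> = exp (- (real (card B) * p / (1 + L) * (\<Sum>a\<in>A. pmf \<mu> (f a))))"
      by (simp add: exp_of_nat_mult[symmetric] mult.assoc)
    \<comment> \<open>Lowering the coefficient to \<open>l\<close> secures the condition l * sqrt
      \<sigma> \<le> 1 of \<open>expectation_exp_neg_pmf_le\<close>, applied below when
      \<open>f\<close> is averaged.\<close>
    also have "\<dots> \<le> exp (- (l * (\<Sum>a\<in>A. pmf \<mu> (f a))))"
      using mult_right_mono[OF l(2), of "\<Sum>a\<in>A. pmf \<mu> (f a)"] by (simp add: sum_nonneg)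
    also have "\<dots> = (\<Prod>a\<in>A. exp (- l * pmf \<mu> (f a)))"
      using fin(2) by (simp add: exp_sum[symmetric] sum_negf sum_distrib_left)
    finally show ?thesis
      by (simp add: add_increasing)
  qed
  have "measure_pmf.expectation (Pi_pmf (A \<union> B) d (\<lambda>_. \<mu>)) (\<lambda>\<tau>. (1 - p) ^ card (mono_pairs (A \<union> B) \<tau>))
      = measure_pmf.expectation (pair_pmf X Y) (\<lambda>z. (1 - p) ^ card (mono_pairs (A \<union> B) (m z)))"
    unfolding Pi_pmf_union[OF fin(2-4)] X_def[symmetric] Y_def[symmetric] m_def by simp
  also have "\<dots> = measure_pmf.expectation X (\<lambda>f. measure_pmf.expectation Y (\<lambda>g. (1 - p) ^ Q f g))"
    unfolding expectation_pair_pmf[OF finX finY] Q_def by simp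
  also have "\<dots> \<le> measure_pmf.expectation X
      (\<lambda>f. exp (- (L\<^sup>2 / (4 * p))) + (\<Prod>a\<in>A. exp (- l * pmf \<mu> (f a))))"
    by (intro pmf_expectation_mono[OF finX] step)
  also have "\<dots> = exp (- (L\<^sup>2 / (4 * p))) + measure_pmf.expectation X (\<lambda>f. \<Prod>a\<in>A. exp (- l * pmf \<mu> (f a)))"
    by (subst Bochner_Integration.integral_add) (auto intro: integrable_measure_pmf_finite[OF finX])
  also have "measure_pmf.expectation X (\<lambda>f. \<Prod>a\<in>A. exp (- l * pmf \<mu> (f a))) =
      (\<Prod>a\<in>A. measure_pmf.expectation \<mu> (\<lambda>t. exp (- l * pmf \<mu> t)))"
    unfolding X_def using fin by (intro expectation_prod_Pi_pmf int\<mu>) auto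
  also have "\<dots> \<le> (\<Prod>a\<in>A. exp (- l * \<sigma> / 2))"
    using expectation_exp_neg_pmf_le[OF fin(1) \<sigma> l(1,3)]
    by (intro prod_mono conjI Bochner_Integration.integral_nonneg) auto
  also have "\<dots> = exp (- (real (card A) * l * \<sigma> / 2))"
    by (simp add: exp_of_nat_mult[symmetric] mult.assoc)
  finally show ?thesis by simp
qed

subsection \<open>Set colourings of random graphs\<close>

lemma prob_random_graph:
  "measure_pmf.prob (random_graph n p) {G. P G} =
   measure_pmf.prob (edge_pmf {1..n} p) {b. P ({1..n}, {e \<in> pairs {1..n}. b e})}"
  by (simp add: random_graph_def edge_pmf_def vimage_def)

lemma set_chromatic_number_le: "set_colouring G k c \<Longrightarrow> set_chromatic_number G \<le> k"
  unfolding set_chromatic_number_def by (rule Least_le) blast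

text \<open>Colours need not all occur, so a colouring with the least number of colours is also one
  with any larger number.\<close>

lemma ex_set_colouring_of_ge:
  assumes "simple_graph G" "finite (verts G)" "set_chromatic_number G \<le> k"
  shows "\<exists>c. set_colouring G k c"
proof -
  obtain c where "set_colouring G (set_chromatic_number G) c"
    unfolding set_chromatic_number_def
    using LeastI[of "\<lambda>k. \<exists>c. set_colouring G k c"] ex_set_colouring[OF assms(1,2)] by blast
  then have "set_colouring G k c"
    using assms(3) unfolding set_colouring_def by (fastforce simp: Pi_iff)
  then show ?thesis by blast
qed

lemma mem_nbr_colours:
  assumes "u \<in> V"
  shows "i \<in> nbr_colours (V, {e \<in> pairs V. b e}) c u \<longleftrightarrow> (\<exists>x\<in>V. x \<noteq> u \<and> c x = i \<and> b {u, x})"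
  using assms by (auto simp: nbr_colours_def insert_commute)

section \<open>Upper bound: small colour classes of equal size\<close>

text \<open>With q = (1 - p)^l the value is 1/2 + 2 (q - 1/2)^2.\<close>

lemma s_val_bounds:
  assumes "0 \<le> p" "p \<le> 1"
  shows "1 / 2 \<le> s_val p l" "s_val p l \<le> 1"
proof -
  define q where "q = (1 - p) ^ l"
  have q: "0 \<le> q" "q \<le> 1" using assms by (auto simp: q_def power_le_one)
  have "0 \<le> (q - 1 / 2) ^ 2" by simp
  then have "1 / 2 \<le> q\<^sup>2 + (1 - q)\<^sup>2" by (simp add: power2_eq_square algebra_simps)
  then show "1 / 2 \<le> s_val p l" by (simp add: s_val_def q_def)
  have "q * q \<le> q" using mult_left_mono[OF q(2,1)] by simp
  then have "q\<^sup>2 + (1 - q)\<^sup>2 \<le> 1" by (simp add: power2_eq_square algebra_simps)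
  then show "s_val p l \<le> 1" by (simp add: s_val_def q_def)
qed

lemma s_val_0 [simp]: "s_val p 0 = 1"
  by (simp add: s_val_def)

text \<open>Consecutive blocks of length \<open>l\<close> receive the colours 1 to \<open>K\<close>,
  and all remaining vertices receive \<open>K + 1\<close>; the shift in \<open>x - 1\<close> is
  there because vertices start at 1.\<close>

lemma ex_colouring_with_classes:
  assumes "K * l \<le> n" "1 \<le> l"
  shows "\<exists>c. c \<in> {1..n} \<rightarrow> {1..K + 1} \<and> (\<forall>i\<in>{1..K}. card {x \<in> {1..n}. c x = i} = l)"
proof -
  define c where "c = (\<lambda>x::nat. if x \<le> K * l then (x - 1) div l + 1 else K + 1)"
  have "card {x \<in> {1..n}. c x = i} = l" if i: "i \<in> {1..K}" for i
  proof -
    obtain j where j: "i = Suc j" "j < K" using i by (cases i) auto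
    have jK: "Suc j * l \<le> K * l" using j by (intro mult_le_mono1) auto
    have "{x \<in> {1..n}. c x = i} = {j * l<..Suc j * l}"
    proof (intro equalityI subsetI)
      fix x assume "x \<in> {x \<in> {1..n}. c x = i}"
      then have x: "1 \<le> x" "(x - 1) div l = j" using j by (auto simp: c_def split: if_splits)
      have "j * l \<le> x - 1"
        using div_times_less_eq_dividend[of "x - 1" l] unfolding x(2) .
      moreover have "x - 1 < Suc j * l"
        using dividend_less_div_times[of l "x - 1"] assms(2) unfolding x(2) by simp
      ultimately show "x \<in> {j * l<..Suc j * l}" using x(1) by auto
    next
      fix x assume x: "x \<in> {j * l<..Suc j * l}"
      then have "(x - 1) div l = j"
        by (intro div_nat_eqI) (auto simp: mult.commute)
      then show "x \<in> {x \<in> {1..n}. c x = i}"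
        using x jK assms(1) j by (auto simp: c_def)
    qed
    then show ?thesis by simp
  qed
  moreover have "c \<in> {1..n} \<rightarrow> {1..K + 1}"
  proof
    fix x assume "x \<in> {1..n}"
    show "c x \<in> {1..K + 1}"
    proof (cases "x \<le> K * l")
      case True
      then have "(x - 1) div l \<le> (K * l) div l" by (intro div_le_mono) auto
      then show ?thesis using assms(2) True by (simp add: c_def)
    qed (simp add: c_def)
  qed
  ultimately show ?thesis by blast
qed

lemma prob_chromatic_le:
  assumes "K * l \<le> n" "1 \<le> l" "0 \<le> p" "p \<le> 1"
  shows "1 - real n ^ 2 * p * s_val p l ^ (K - 2) \<le>
         measure_pmf.prob (random_graph n p) {G. set_chromatic_number G \<le> K + 1}"
proof -
  define V where "V = {1..n}"
  define s where "s = s_val p l"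
  have s: "0 \<le> s" "s \<le> 1" using s_val_bounds[OF assms(3,4), of l] by (auto simp: s_def)
  let ?D = "edge_pmf V p" and ?G = "\<lambda>b. (V, {e \<in> pairs V. b e})"
  have fin: "finite V" by (simp add: V_def)
  obtain c where c: "c \<in> V \<rightarrow> {1..K + 1}" "\<And>i. i \<in> {1..K} \<Longrightarrow> card {x \<in> V. c x = i} = l"
    using ex_colouring_with_classes[OF assms(1,2)] unfolding V_def by blast
  \<comment> \<open>Removing the classes of \<open>u\<close> and \<open>v\<close> as a whole
    excludes both vertices and leaves every other class with colour at most \<open>K\<close> at full
    size \<open>l\<close>. The class of colour \<open>K + 1\<close>, whose size is not controlled,
    is never recorded by the types.\<close>
  define S where "S = (\<lambda>u v. {x \<in> V. c x \<noteq> c u \<and> c x \<noteq> c v})"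
  define Bad where
    "Bad = (\<lambda>(u, v). {b. b {u, v} \<and> colour_type (S u v) c K b u = colour_type (S u v) c K b v})"
  define I where "I = {(u, v) \<in> V \<times> V. u \<noteq> v}"
  have finI: "finite I" unfolding I_def using fin by (auto intro: finite_subset[of _ "V \<times> V"])
  have cardI: "real (card I) \<le> real n ^ 2"
  proof -
    have "card I \<le> card (V \<times> V)" unfolding I_def using fin by (intro card_mono) auto
    then show ?thesis by (simp add: V_def power2_eq_square flip: of_nat_mult)
  qed
  have bad: "measure_pmf.prob ?D (Bad z) \<le> p * s ^ (K - 2)" if zI: "z \<in> I" for z
  proof -
    obtain u v where z: "z = (u, v)" "u \<in> V" "v \<in> V" "u \<noteq> v" using zI unfolding I_def by blast
    have "measure_pmf.prob ?D (Bad z) = p * (\<Prod>i\<in>{1..K}. s_val p (card {x \<in> S u v. c x = i}))"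
      unfolding Bad_def z(1) prod.case
      by (rule prob_edge_same_type[OF fin _ z(2-4) assms(3,4)]) (auto simp: S_def)
    also have "(\<Prod>i\<in>{1..K}. s_val p (card {x \<in> S u v. c x = i})) = (\<Prod>i\<in>{1..K}. if i \<in> {c u, c v} then 1 else s)"
    proof (rule prod.cong)
      fix i assume i: "i \<in> {1..K}"
      show "s_val p (card {x \<in> S u v. c x = i}) = (if i \<in> {c u, c v} then 1 else s)"
      proof (cases "i \<in> {c u, c v}")
        case True
        then have "{x \<in> S u v. c x = i} = {}" by (auto simp: S_def)
        then have "card {x \<in> S u v. c x = i} = 0" by (simp only: card.empty)
        with True show ?thesis by (simp del: insert_iff)
      next
        case False
        then have "{x \<in> S u v. c x = i} = {x \<in> V. c x = i}" by (auto simp: S_def)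
        with False show ?thesis using c(2)[OF i] by (simp add: s_def)
      qed
    qed simp
    also have "\<dots> = s ^ card ({1..K} - {c u, c v})"
      by (subst prod.If_cases) (simp_all add: Diff_eq Compl_eq)
    \<comment> \<open>If \<open>c u = c v\<close>, or one of them is \<open>K + 1\<close>, fewer
      than two factors are lost.\<close>
    also have "\<dots> \<le> s ^ (K - 2)"
    proof (rule power_decreasing)
      have "card {c u, c v} \<le> 2" by (simp add: card_insert_if)
      then show "K - 2 \<le> card ({1..K} - {c u, c v})"
        using diff_card_le_card_Diff[of "{c u, c v}" "{1..K}"] by simp
    qed (use s in auto)
    finally show ?thesis using assms(3) by (simp add: mult_left_mono)
  qed
  have sub: "{b. \<not> set_chromatic_number (?G b) \<le> K + 1} \<subseteq> (\<Union>z\<in>I. Bad z)"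
  proof
    fix b assume "b \<in> {b. \<not> set_chromatic_number (?G b) \<le> K + 1}"
    then have "\<not> set_colouring (?G b) (K + 1) c" using set_chromatic_number_le by blast
    then obtain u v where uv: "{u, v} \<in> pairs V" "b {u, v}"
        "nbr_colours (?G b) c u = nbr_colours (?G b) c v"
      using c(1) by (auto simp: set_colouring_def)
    have V: "u \<in> V" "v \<in> V" "u \<noteq> v" using uv(1) by auto
    \<comment> \<open>The types on \<open>S u v\<close> record exactly the neighbourhood colours up
      to \<open>K\<close> other than \<open>c u\<close> and \<open>c v\<close>, so equal
      neighbourhood colour sets force equal types.\<close>
    have "(\<exists>x\<in>S u v. c x = i \<and> b {w, x}) \<longleftrightarrow> i \<notin> {c u, c v} \<and> i \<in> nbr_colours (?G b) c w"
      if "w \<in> {u, v}" for i w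
      using that V mem_nbr_colours[of w V i b c] by (auto simp: S_def)
    then have "colour_type (S u v) c K b u = colour_type (S u v) c K b v"
      unfolding colour_type_def using uv(3) by (intro ext) simp
    then show "b \<in> (\<Union>z\<in>I. Bad z)"
      using uv(2) V by (auto simp: Bad_def I_def)
  qed
  have "measure_pmf.prob ?D {b. \<not> set_chromatic_number (?G b) \<le> K + 1} \<le> measure_pmf.prob ?D (\<Union>z\<in>I. Bad z)"
    by (intro measure_pmf.finite_measure_mono sub) auto
  also have "\<dots> \<le> (\<Sum>z\<in>I. measure_pmf.prob ?D (Bad z))"
    using finI by (intro measure_pmf.finite_measure_subadditive_finite) auto
  also have "\<dots> \<le> real (card I) * (p * s ^ (K - 2))"
    by (intro sum_bounded_above bad)
  also have "\<dots> \<le> real n ^ 2 * (p * s ^ (K - 2))"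
    using assms(3) s by (intro mult_right_mono cardI) auto
  finally show ?thesis
    using prob_not_pmf[of ?D "\<lambda>b. set_chromatic_number (?G b) \<le> K + 1"]
    unfolding prob_random_graph V_def[symmetric] s_def by (simp add: mult.assoc)
qed

section \<open>Lower bound: types determine neighbourhood colour sets\<close>

text \<open>Every colour class either is small, and then goes into \<open>S\<close> as a whole, or contains \<open>K\<close> vertices that are
  jointly adjacent to all but fewer than \<open>K\<close> vertices; the former \<open>K\<close> vertices and the exceptions go into \<open>S\<close>.\<close>

lemma ex_types_determine_nbr_colours:
  assumes fin: "finite V" and c: "c \<in> V \<rightarrow> {1..k}" and size: "2 * k * K \<le> card V"
    and dense: "\<And>T U. T \<subseteq> V \<Longrightarrow> U \<subseteq> V \<Longrightarrow> T \<inter> U = {} \<Longrightarrow> card T = K \<Longrightarrow> card U = K \<Longrightarrow>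
      \<exists>t\<in>T. \<exists>u\<in>U. b {t, u}"
  shows "\<exists>S\<subseteq>V. card S = 2 * k * K \<and>
    (\<forall>u\<in>V - S. nbr_colours (V, {e \<in> pairs V. b e}) c u = {i. colour_type S c k b u i})"
proof -
  define C where "C = (\<lambda>i. {x \<in> V. c x = i})"
  have "\<exists>R\<subseteq>V. card R \<le> 2 * K \<and> (C i \<subseteq> R \<or> (\<forall>u\<in>V - R. \<exists>x\<in>C i \<inter> R. b {u, x}))" for i
  proof (cases "card (C i) < K")
    case True
    then show ?thesis by (intro exI[of _ "C i"]) (auto simp: C_def)
  next
    case False
    then obtain T where T: "T \<subseteq> C i" "card T = K"
      using obtain_subset_with_card_n[of K "C i"] by (metis not_less)
    define U where "U = {u \<in> V - T. \<forall>x\<in>T. \<not> b {u, x}}"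
    have TV: "T \<subseteq> V" using T by (auto simp: C_def)
    have "card U < K"
    proof (rule ccontr)
      assume "\<not> card U < K"
      then obtain U' where U': "U' \<subseteq> U" "card U' = K"
        using obtain_subset_with_card_n[of K U] by (metis not_less)
      have "U' \<subseteq> V" "T \<inter> U' = {}" using U' by (auto simp: U_def)
      then obtain t u where "t \<in> T" "u \<in> U'" "b {t, u}"
        using dense[OF TV _ _ T(2) U'(2)] by blast
      then show False using U'(1) by (auto simp: U_def insert_commute)
    qed
    moreover have "card (T \<union> U) \<le> card T + card U" by (rule card_Un_le)
    ultimately have "card (T \<union> U) \<le> 2 * K" using T(2) by linarith
    moreover have "T \<union> U \<subseteq> V" using TV by (auto simp: U_def)
    moreover have "\<forall>u\<in>V - (T \<union> U). \<exists>x\<in>C i \<inter> (T \<union> U). b {u, x}"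
      using T(1) by (auto simp: U_def)
    ultimately show ?thesis by blast
  qed
  then have "\<forall>i. \<exists>R. R \<subseteq> V \<and> card R \<le> 2 * K \<and> (C i \<subseteq> R \<or> (\<forall>u\<in>V - R. \<exists>x\<in>C i \<inter> R. b {u, x}))"
    by blast
  then obtain R where R: "\<And>i. R i \<subseteq> V" "\<And>i. card (R i) \<le> 2 * K"
      "\<And>i. C i \<subseteq> R i \<or> (\<forall>u\<in>V - R i. \<exists>x\<in>C i \<inter> R i. b {u, x})"
    by metis
  have "card (\<Union>i\<in>{1..k}. R i) \<le> (\<Sum>i\<in>{1..k}. card (R i))"
    by (rule card_UN_le) simp
  also have "\<dots> \<le> (\<Sum>i\<in>{1..k}. 2 * K)" by (intro sum_mono R)
  finally have "card (\<Union>i\<in>{1..k}. R i) \<le> 2 * k * K" by simp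
  \<comment> \<open>Padding to exactly \<open>2 * k * K\<close> vertices lets the later union bound
    range over sets of one size.\<close>
  then obtain S where S: "(\<Union>i\<in>{1..k}. R i) \<subseteq> S" "S \<subseteq> V" "card S = 2 * k * K"
    using exists_subset_between[of "\<Union>i\<in>{1..k}. R i" "2 * k * K" V] size fin R(1) by blast
  have "i \<in> nbr_colours (V, {e \<in> pairs V. b e}) c u \<longleftrightarrow> colour_type S c k b u i" if u: "u \<in> V - S" for u i
  proof -
    have uV: "u \<in> V" "u \<notin> S" using u by auto
    show ?thesis
    proof (cases "i \<in> {1..k}")
      case False
      then show ?thesis
        using c by (auto simp: mem_nbr_colours[OF uV(1)] colour_type_def)
    next
      case True
      have RS: "R i \<subseteq> S" using S(1) True by blast
      have "(\<exists>x\<in>V. x \<noteq> u \<and> c x = i \<and> b {u, x}) \<longleftrightarrow> (\<exists>x\<in>S. c x = i \<and> b {u, x})"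
      proof
        assume "\<exists>x\<in>V. x \<noteq> u \<and> c x = i \<and> b {u, x}"
        then obtain x where x: "x \<in> C i" "b {u, x}" by (auto simp: C_def)
        have "u \<in> V - R i" using uV RS by blast
        then have "\<exists>y\<in>C i \<inter> R i. b {u, y}" using R(3)[of i] x by blast
        then obtain y where "y \<in> C i" "y \<in> R i" "b {u, y}" by blast
        moreover have "c y = i" using \<open>y \<in> C i\<close> by (simp add: C_def)
        ultimately show "\<exists>x\<in>S. c x = i \<and> b {u, x}" using RS by blast
      next
        assume "\<exists>x\<in>S. c x = i \<and> b {u, x}"
        then obtain x where x: "x \<in> S" "c x = i" "b {u, x}" by blast
        moreover have "x \<in> V" "x \<noteq> u" using x(1) S(2) uV by auto
        ultimately show "\<exists>x\<in>V. x \<noteq> u \<and> c x = i \<and> b {u, x}" by blast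
      qed
      with True show ?thesis
        by (simp add: mem_nbr_colours[OF uV(1)] colour_type_def)
    qed
  qed
  then show ?thesis using S(2,3) by blast
qed

text \<open>Union bound over at most n^(2 K) pairs of sets; disjointness makes the K^2 pairs joining
  them distinct.\<close>

lemma prob_not_dense_le:
  assumes "0 \<le> p" "p \<le> 1"
  shows "measure_pmf.prob (edge_pmf {1..n} p)
    {b. \<exists>T U. T \<subseteq> {1..n} \<and> U \<subseteq> {1..n} \<and> T \<inter> U = {} \<and> card T = K \<and> card U = K \<and> (\<forall>t\<in>T. \<forall>u\<in>U. \<not> b {t, u})}
    \<le> real n ^ (2 * K) * (1 - p) ^ (K * K)"
proof -
  let ?D = "edge_pmf {1..n} p"
  define P where "P = {T. T \<subseteq> {1..n} \<and> card T = K}"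
  define I where "I = {(T, U) \<in> P \<times> P. T \<inter> U = {}}"
  define F where "F = (\<lambda>(T, U). {b :: nat set \<Rightarrow> bool. \<forall>t\<in>T. \<forall>u\<in>U. \<not> b {t, u}})"
  have finP: "finite P" unfolding P_def by (rule finite_subset[of _ "Pow {1..n}"]) auto
  have finI: "finite I" unfolding I_def using finP by (auto intro: finite_subset[of _ "P \<times> P"])
  have "card P = n choose K" unfolding P_def by (simp add: n_subsets)
  also have "\<dots> \<le> n ^ K" by (cases "K \<le> n") (auto simp: binomial_le_pow binomial_eq_0)
  finally have cardP: "card P \<le> n ^ K" .
  have "card I \<le> card (P \<times> P)" unfolding I_def using finP by (intro card_mono) auto
  also have "\<dots> \<le> n ^ K * n ^ K" using cardP by (simp add: card_cartesian_product mult_le_mono)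
  also have "\<dots> = n ^ (2 * K)" by (simp add: mult_2 power_add)
  finally have "real (card I) \<le> real (n ^ (2 * K))" by (rule of_nat_mono)
  then have cardI: "real (card I) \<le> real n ^ (2 * K)" by simp
  have F: "measure_pmf.prob ?D (F z) \<le> (1 - p) ^ (K * K)" if zI: "z \<in> I" for z
  proof -
    obtain T U where z: "z = (T, U)" "T \<subseteq> {1..n}" "U \<subseteq> {1..n}" "T \<inter> U = {}" "card T = K" "card U = K"
      using zI unfolding I_def P_def by blast
    define E where "E = (\<lambda>(t, u). {t, u}) ` (T \<times> U)"
    have "card E = K * K"
      unfolding E_def using z by (subst card_image) (auto simp: inj_on_def doubleton_eq_iff card_cartesian_product)
    moreover have "F z = {b. \<forall>e\<in>E. \<not> b e}" by (auto simp: F_def z(1) E_def)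
    moreover have "E \<subseteq> pairs {1..n}"
    proof
      fix e assume "e \<in> E"
      then obtain t u where e: "e = {t, u}" "t \<in> T" "u \<in> U" by (auto simp: E_def)
      have "t \<in> {1..n}" "u \<in> {1..n}" "t \<noteq> u" using e(2,3) z(2-4) by blast+
      then show "e \<in> pairs {1..n}" unfolding e(1) doubleton_in_pairs by blast
    qed
    ultimately show ?thesis
      using prob_all_False_Pi_bernoulli[of "pairs {1..n}" E p] assms by (simp add: edge_pmf_def)
  qed
  have "{b. \<exists>T U. T \<subseteq> {1..n} \<and> U \<subseteq> {1..n} \<and> T \<inter> U = {} \<and> card T = K \<and> card U = K \<and>
      (\<forall>t\<in>T. \<forall>u\<in>U. \<not> b {t, u})} = (\<Union>z\<in>I. F z)"
    by (auto simp: I_def P_def F_def)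
  moreover have "measure_pmf.prob ?D (\<Union>z\<in>I. F z) \<le> (\<Sum>z\<in>I. measure_pmf.prob ?D (F z))"
    using finI by (intro measure_pmf.finite_measure_subadditive_finite) auto
  moreover have "\<dots> \<le> real (card I) * (1 - p) ^ (K * K)"
    by (intro sum_bounded_above F)
  moreover have "\<dots> \<le> real n ^ (2 * K) * (1 - p) ^ (K * K)"
    using assms by (intro mult_right_mono cardI) auto
  ultimately show ?thesis by simp
qed

text \<open>Either two disjoint \<open>K\<close>-sets have no edge between them, or outside some
  \<open>S\<close> of \<open>2 * k * K\<close> vertices equal types mean equal neighbourhood colour
  sets, so no pair of equal type is an edge. The latter event sees the colouring only through its
  restriction to \<open>S\<close>, which limits the number of choices.\<close>

lemma prob_set_colourable_le:
  fixes n k K :: nat and p \<beta> :: real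
  assumes "0 \<le> p" "p \<le> 1" and size: "2 * k * K \<le> n"
    and \<beta>: "\<And>S c. S \<subseteq> {1..n} \<Longrightarrow> card S = 2 * k * K \<Longrightarrow>
      measure_pmf.expectation (Pi_pmf ({1..n} - S) (\<lambda>_. False) (\<lambda>_. type_pmf p S c k))
        (\<lambda>\<tau>. (1 - p) ^ card (mono_pairs ({1..n} - S) \<tau>)) \<le> \<beta>"
  shows "measure_pmf.prob (random_graph n p) {G. \<exists>c. set_colouring G k c}
    \<le> real n ^ (2 * K) * (1 - p) ^ (K * K) + (real n * real k) ^ (2 * k * K) * \<beta>"
proof -
  define V where "V = {1..n}"
  define R where "R = 2 * k * K"
  let ?D = "edge_pmf V p" and ?G = "\<lambda>b. (V, {e \<in> pairs V. b e})"
  have fin: "finite V" "card V = n" by (auto simp: V_def)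
  define N where "N = {b. \<exists>T U. T \<subseteq> V \<and> U \<subseteq> V \<and> T \<inter> U = {} \<and> card T = K \<and> card U = K \<and>
    (\<forall>t\<in>T. \<forall>u\<in>U. \<not> b {t, u})}"
  \<comment> \<open>Colourings of \<open>S\<close> are taken as extensional functions, so each
    \<open>S\<close> contributes only k^R of them.\<close>
  define I where "I = (SIGMA S:{S. S \<subseteq> V \<and> card S = R}. PiE S (\<lambda>_. {1..k}))"
  define F where "F = (\<lambda>(S, c). {b. \<forall>e\<in>mono_pairs (V - S) (colour_type S c k b). \<not> b e})"
  have finP: "finite {S. S \<subseteq> V \<and> card S = R}"
    using fin by (auto intro: finite_subset[of _ "Pow V"])
  have finI: "finite I"
    unfolding I_def using finP fin by (intro finite_SigmaI finite_PiE) (auto intro: finite_subset)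
  have finS: "finite S" if "S \<subseteq> V" for S
    using that fin(1) by (rule finite_subset)
  have "card I = (\<Sum>S | S \<subseteq> V \<and> card S = R. card (PiE S (\<lambda>_. {1..k})))"
    unfolding I_def using finP finS by (intro card_SigmaI) (auto intro!: finite_PiE)
  also have "\<dots> = (\<Sum>S | S \<subseteq> V \<and> card S = R. k ^ R)"
    using finS by (intro sum.cong) (auto simp: card_PiE)
  also have "\<dots> = (n choose R) * k ^ R" using n_subsets[OF fin(1)] fin by simp
  also have "\<dots> \<le> n ^ R * k ^ R" by (cases "R \<le> n") (auto simp: binomial_le_pow binomial_eq_0)
  finally have "real (card I) \<le> real (n ^ R * k ^ R)" by (rule of_nat_mono)
  then have cardI: "real (card I) \<le> (real n * real k) ^ R" by (simp add: power_mult_distrib)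
  have F: "measure_pmf.prob ?D (F z) \<le> \<beta>" if zI: "z \<in> I" for z
  proof -
    obtain S c where z: "z = (S, c)" "S \<subseteq> V" "card S = R" using zI unfolding I_def by blast
    show ?thesis
      using prob_no_mono_edge[OF fin(1) z(2) refl assms(1,2), of c k] \<beta>[of S c] z(2,3)
      unfolding z(1) F_def V_def R_def by simp
  qed
  have sub: "{b. \<exists>c. set_colouring (?G b) k c} \<subseteq> N \<union> (\<Union>z\<in>I. F z)"
  proof
    fix b assume "b \<in> {b. \<exists>c. set_colouring (?G b) k c}"
    then obtain c where c: "set_colouring (?G b) k c" by blast
    then have cV: "c \<in> V \<rightarrow> {1..k}" by (simp add: set_colouring_def)
    show "b \<in> N \<union> (\<Union>z\<in>I. F z)"
    proof (cases "b \<in> N")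
      case False
      have "\<exists>S\<subseteq>V. card S = 2 * k * K \<and>
          (\<forall>u\<in>V - S. nbr_colours (?G b) c u = {i. colour_type S c k b u i})"
        using False size fin by (intro ex_types_determine_nbr_colours cV) (auto simp: N_def)
      then obtain S where S: "S \<subseteq> V" "card S = R"
          "\<And>u. u \<in> V - S \<Longrightarrow> nbr_colours (?G b) c u = {i. colour_type S c k b u i}"
        unfolding R_def by blast
      have res: "colour_type S (restrict c S) k b = colour_type S c k b"
        by (auto simp: colour_type_def fun_eq_iff)
      have "\<not> b e" if e: "e \<in> mono_pairs (V - S) (colour_type S c k b)" for e
      proof
        assume "b e"
        obtain u v where uv: "e = {u, v}" "u \<noteq> v" "u \<in> V - S" "v \<in> V - S"
          using e unfolding mono_pairs_def pairs_def card_2_iff by blast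
        have "colour_type S c k b u = colour_type S c k b v"
          using e uv(1) unfolding mono_pairs_def by blast
        then have "nbr_colours (?G b) c u = nbr_colours (?G b) c v"
          using S(3)[OF uv(3)] S(3)[OF uv(4)] by simp
        moreover have "{u, v} \<in> edges (?G b)" using \<open>b e\<close> uv by simp
        ultimately show False using c unfolding set_colouring_def by blast
      qed
      then have "b \<in> F (S, restrict c S)" by (simp add: F_def res)
      moreover have "(S, restrict c S) \<in> I" using S(1,2) cV by (auto simp: I_def)
      ultimately show ?thesis by blast
    qed simp
  qed
  have "measure_pmf.prob ?D {b. \<exists>c. set_colouring (?G b) k c} \<le> measure_pmf.prob ?D (N \<union> (\<Union>z\<in>I. F z))"
    by (intro measure_pmf.finite_measure_mono sub) auto
  also have "\<dots> \<le> measure_pmf.prob ?D N + measure_pmf.prob ?D (\<Union>z\<in>I. F z)"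
    by (rule measure_Un_le) auto
  also have "measure_pmf.prob ?D N \<le> real n ^ (2 * K) * (1 - p) ^ (K * K)"
    unfolding N_def V_def by (rule prob_not_dense_le[OF assms(1,2)])
  also have "measure_pmf.prob ?D (\<Union>z\<in>I. F z) \<le> (\<Sum>z\<in>I. measure_pmf.prob ?D (F z))"
    using finI by (intro measure_pmf.finite_measure_subadditive_finite) auto
  also have "\<dots> \<le> real (card I) * \<beta>"
    by (intro sum_bounded_above F)
  also have "\<dots> \<le> (real n * real k) ^ R * \<beta>"
  proof -
    have "0 \<le> \<beta>"
    proof -
      obtain S where "S \<subseteq> {1..n}" "card S = 2 * k * K"
        using obtain_subset_with_card_n[of "2 * k * K" "{1..n}"] size by auto
      from \<beta>[OF this] assms(2) show ?thesis
        by (meson Bochner_Integration.integral_nonneg diff_ge_0_iff_ge order_trans zero_le_power)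
    qed
    then show ?thesis by (intro mult_right_mono cardI)
  qed
  finally show ?thesis
    unfolding prob_random_graph V_def[symmetric] R_def by simp
qed

subsection \<open>Probability of a set colouring with few colours\<close>

text \<open>Fixes \<open>K\<close> in the preceding bound. \<open>size\<close> keeps
  \<open>S\<close> below n / 2 vertices, and the (n k)^(2 k K) \<le> n^(4 k K) choices of
  \<open>S\<close> and its colouring cost at most exp (16 k (ln n)^2 / p).\<close>

lemma prob_set_colourable_le_exp:
  fixes n k :: nat and p \<beta> :: real
  assumes n: "3 \<le> n" and p: "0 < p" "p \<le> 1" and k: "k \<le> n" and size: "16 * real k * ln (real n) \<le> real n * p"
    and \<beta>: "\<And>S c. S \<subseteq> {1..n} \<Longrightarrow> real (card S) \<le> real n / 2 \<Longrightarrow>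
      measure_pmf.expectation (Pi_pmf ({1..n} - S) (\<lambda>_. False) (\<lambda>_. type_pmf p S c k))
        (\<lambda>\<tau>. (1 - p) ^ card (mono_pairs ({1..n} - S) \<tau>)) \<le> \<beta>"
  shows "measure_pmf.prob (random_graph n p) {G. \<exists>c. set_colouring G k c}
    \<le> 1 / real n + exp (16 * real k * (ln (real n))\<^sup>2 / p) * \<beta>"
proof -
  define x where "x = ln (real n)"
  have x1: "1 \<le> x"
  proof -
    have "exp 1 \<le> real n" using exp_le n by linarith
    then show ?thesis unfolding x_def using n by (subst ln_ge_iff) auto
  qed
  have n_exp: "real n = exp x" using n by (simp add: x_def)
  \<comment> \<open>From K \<ge> 3 x / p follows p K^2 \<ge> 3 x K, hence n^(2 K) (1 - p)^(K^2)
    \<le> exp (- x K) \<le> 1 / n. Since x / p \<ge> 1, rounding up keeps K \<le> 4 x / p.\<close>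
  define K where "K = nat \<lceil>3 * x / p\<rceil>"
  have K: "3 * x / p \<le> real K" "real K \<le> 4 * x / p" "1 \<le> K"
  proof -
    show 1: "3 * x / p \<le> real K" unfolding K_def by linarith
    have "1 \<le> x / p" using x1 p by (simp add: field_simps)
    moreover have "0 \<le> 3 * x / p" using x1 p by simp
    then have "real K \<le> 3 * x / p + 1" unfolding K_def by linarith
    ultimately have "real K \<le> 4 * (x / p)" by simp
    then show "real K \<le> 4 * x / p" by simp
    have "3 * (x / p) \<le> real K" using 1 by simp
    then show "1 \<le> K" using \<open>1 \<le> x / p\<close> by linarith
  qed
  define R where "R = 2 * k * K"
  have R: "real R \<le> 8 * real k * x / p"
    using mult_left_mono[OF K(2), of "2 * real k"] by (simp add: R_def)
  also have "\<dots> \<le> real n / 2"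
    using size p by (simp add: x_def field_simps)
  finally have R2: "real R \<le> real n / 2" .
  have "\<beta> \<ge> 0"
  proof -
    have "measure_pmf.expectation (Pi_pmf ({1..n} - {}) (\<lambda>_. False) (\<lambda>_. type_pmf p {} (\<lambda>_. 0) k))
        (\<lambda>\<tau>. (1 - p) ^ card (mono_pairs ({1..n} - {}) \<tau>)) \<le> \<beta>"
      by (rule \<beta>) auto
    moreover have "0 \<le> measure_pmf.expectation (Pi_pmf ({1..n} - {}) (\<lambda>_. False) (\<lambda>_. type_pmf p {} (\<lambda>_. 0) k))
        (\<lambda>\<tau>. (1 - p) ^ card (mono_pairs ({1..n} - {}) \<tau>))"
      using p by (intro Bochner_Integration.integral_nonneg) auto
    ultimately show ?thesis by linarith
  qed
  have "real n ^ (2 * K) * (1 - p) ^ (K * K) \<le> exp x ^ (2 * K) * exp (- p) ^ (K * K)"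
    unfolding n_exp using exp_ge_add_one_self[of "- p"] p by (intro mult_left_mono power_mono) auto
  also have "\<dots> = exp (2 * real K * x - p * real K * real K)"
    by (simp add: exp_of_nat_mult[symmetric] exp_add[symmetric] exp_diff mult_ac exp_minus divide_inverse power_inverse)
  also have "\<dots> \<le> exp (- x)"
  proof -
    have "3 * x \<le> p * real K" using K(1) p by (simp add: field_simps)
    then have "3 * x * real K \<le> p * real K * real K" by (intro mult_right_mono) auto
    moreover have "x * 1 \<le> x * real K" using x1 K(3) by (intro mult_left_mono) auto
    ultimately show ?thesis by (simp add: algebra_simps)
  qed
  also have "\<dots> = 1 / real n" by (simp add: n_exp exp_minus field_simps)
  finally have first: "real n ^ (2 * K) * (1 - p) ^ (K * K) \<le> 1 / real n" .
  have "(real n * real k) ^ R \<le> (real n * real n) ^ R"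
    using k by (intro power_mono mult_left_mono) auto
  also have "\<dots> = exp (2 * x * real R)"
    by (simp add: n_exp exp_of_nat_mult[symmetric] exp_add[symmetric] mult_ac)
  also have "\<dots> \<le> exp (16 * real k * x\<^sup>2 / p)"
    using mult_left_mono[OF R, of "2 * x"] x1 by (simp add: power2_eq_square mult_ac)
  finally have second: "(real n * real k) ^ R \<le> exp (16 * real k * x\<^sup>2 / p)" .
  have "measure_pmf.prob (random_graph n p) {G. \<exists>c. set_colouring G k c}
      \<le> real n ^ (2 * K) * (1 - p) ^ (K * K) + (real n * real k) ^ (2 * k * K) * \<beta>"
  proof (rule prob_set_colourable_le)
    show "2 * k * K \<le> n" using R2 by (simp add: R_def flip: of_nat_le_iff[where 'a = real])
    fix S c assume "S \<subseteq> {1..n}" "card S = 2 * k * K"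
    then show "measure_pmf.expectation (Pi_pmf ({1..n} - S) (\<lambda>_. False) (\<lambda>_. type_pmf p S c k))
        (\<lambda>\<tau>. (1 - p) ^ card (mono_pairs ({1..n} - S) \<tau>)) \<le> \<beta>"
      using R2 by (intro \<beta>) (auto simp: R_def)
  qed (use p in auto)
  also have "\<dots> \<le> 1 / real n + exp (16 * real k * x\<^sup>2 / p) * \<beta>"
    using first mult_right_mono[OF second \<open>\<beta> \<ge> 0\<close>] by (simp add: R_def)
  finally show ?thesis by (simp add: x_def)
qed

text \<open>There are at most 2^k types for at least n / 2 vertices, so for every outcome at least
  (n / 2)^2 / (4 * 2^k) pairs have equal type; \<open>types\<close> supplies the condition 2 * 2^k
  \<le> n / 2.\<close>

lemma prob_set_colourable_le_few_types:
  fixes n k :: nat and p :: real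
  assumes n: "3 \<le> n" and p: "0 < p" "p \<le> 1" and k: "k \<le> n" and size: "16 * real k * ln (real n) \<le> real n * p"
    and types: "4 * 2 ^ k \<le> real n"
  shows "measure_pmf.prob (random_graph n p) {G. \<exists>c. set_colouring G k c}
    \<le> 1 / real n + exp (16 * real k * (ln (real n))\<^sup>2 / p) * exp (- (p * (real n)\<^sup>2 / (16 * 2 ^ k)))"
proof (rule prob_set_colourable_le_exp[OF n p k size])
  fix S :: "nat set" and c assume S: "S \<subseteq> {1..n}" "real (card S) \<le> real n / 2"
  define W where "W = {1..n} - S"
  define D where "D = Pi_pmf W (\<lambda>_. False) (\<lambda>_. type_pmf p S c k)"
  have finW: "finite W" by (simp add: W_def)
  have "card W = n - card S" using S(1) by (simp add: W_def card_Diff_subset finite_subset)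
  then have w: "real n / 2 \<le> real (card W)" using S(2) by linarith
  have finD: "finite (set_pmf D)"
    unfolding D_def by (rule finite_set_Pi_pmf[OF finW finite_set_type_pmf])
  have "measure_pmf.expectation D (\<lambda>\<tau>. (1 - p) ^ card (mono_pairs W \<tau>)) \<le>
      measure_pmf.expectation D (\<lambda>_. exp (- (p * (real n)\<^sup>2 / (16 * 2 ^ k))))"
  proof (rule pmf_expectation_mono[OF finD])
    fix \<tau> assume \<tau>: "\<tau> \<in> set_pmf D"
    define X where "X = (\<lambda>I i. i \<in> I) ` Pow {1..k}"
    have X: "finite X" "real (card X) \<le> 2 ^ k"
    proof -
      show "finite X" by (simp add: X_def)
      have "card X \<le> card (Pow {1..k})" unfolding X_def by (rule card_image_le) simp
      then have "real (card X) \<le> real (2 ^ k)" by (intro of_nat_mono) (simp add: card_Pow)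
      then show "real (card X) \<le> 2 ^ k" by simp
    qed
    have "\<tau> u \<in> X" if u: "u \<in> W" for u
    proof -
      have "\<tau> u \<in> set_pmf (type_pmf p S c k)"
        using \<tau> u unfolding D_def set_Pi_pmf[OF finW] PiE_dflt_def by auto
      then have "\<forall>i. i \<notin> {1..k} \<longrightarrow> \<tau> u i = False"
        using set_Pi_pmf_subset[of "{1..k}" False] unfolding type_pmf_def by blast
      then have "\<tau> u = (\<lambda>i. i \<in> {i. \<tau> u i})" "{i. \<tau> u i} \<in> Pow {1..k}" by auto
      then show ?thesis unfolding X_def by blast
    qed
    then have "(real (card W))\<^sup>2 / (4 * 2 ^ k) \<le> real (card (mono_pairs W \<tau>))"
      using X types w by (intro card_mono_pairs_ge_of_few_types[OF finW _ X(1)]) auto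
    moreover have "(real n / 2)\<^sup>2 / (4 * 2 ^ k) \<le> (real (card W))\<^sup>2 / (4 * 2 ^ k)"
      using w by (intro divide_right_mono power_mono) auto
    ultimately have "(real n)\<^sup>2 / (16 * 2 ^ k) \<le> real (card (mono_pairs W \<tau>))"
      by (simp add: power_divide)
    then have "p * ((real n)\<^sup>2 / (16 * 2 ^ k)) \<le> p * real (card (mono_pairs W \<tau>))"
      using p by (intro mult_left_mono) auto
    then have "exp (- (p * real (card (mono_pairs W \<tau>)))) \<le> exp (- (p * (real n)\<^sup>2 / (16 * 2 ^ k)))"
      by simp
    then show "(1 - p) ^ card (mono_pairs W \<tau>) \<le> exp (- (p * (real n)\<^sup>2 / (16 * 2 ^ k)))"
      using one_minus_power_le_exp[of p "card (mono_pairs W \<tau>)"] p by linarith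
  qed
  then show "measure_pmf.expectation (Pi_pmf ({1..n} - S) (\<lambda>_. False) (\<lambda>_. type_pmf p S c k))
        (\<lambda>\<tau>. (1 - p) ^ card (mono_pairs ({1..n} - S) \<tau>)) \<le> exp (- (p * (real n)\<^sup>2 / (16 * 2 ^ k)))"
    by (simp add: D_def W_def)
qed

text \<open>For k so large that counting types says nothing. The vertices outside \<open>S\<close>
  are halved into \<open>A\<close> and \<open>B\<close> for
  \<open>expectation_mono_pairs_le\<close>, and the collision probability \<sigma> is at least s^k,
  whatever the colour classes of \<open>S\<close> are.\<close>

lemma prob_set_colourable_le_random_types:
  fixes n k :: nat and p s L :: real
  assumes n: "4 \<le> n" and p: "0 < p" "p \<le> 1" and k: "k \<le> n" and size: "16 * real k * ln (real n) \<le> real n * p"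
    and s: "0 < s" "\<And>l. s \<le> s_val p l" and L: "2 \<le> L"
  shows "measure_pmf.prob (random_graph n p) {G. \<exists>c. set_colouring G k c}
    \<le> 1 / real n + exp (16 * real k * (ln (real n))\<^sup>2 / p) *
      (exp (- (L\<^sup>2 / (4 * p))) +
       exp (- (real n / 16 * min (real n * p * s ^ k / (8 * (1 + L))) (sqrt (s ^ k)))))"
proof (rule prob_set_colourable_le_exp[OF _ p k size])
  show "3 \<le> n" using n by simp
  fix S :: "nat set" and c assume S: "S \<subseteq> {1..n}" "real (card S) \<le> real n / 2"
  define W where "W = {1..n} - S"
  define \<mu> where "\<mu> = type_pmf p S c k"
  define \<sigma> where "\<sigma> = measure_pmf.expectation \<mu> (pmf \<mu>)"
  define m where "m = card W div 2"
  have finW: "finite W" by (simp add: W_def)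
  have "card W = n - card S" using S(1) by (simp add: W_def card_Diff_subset finite_subset)
  then have w: "real n / 2 \<le> real (card W)" using S(2) by linarith
  \<comment> \<open>Halving rounds down; n \<ge> 4 makes (n / 2 - 1) / 2 at least n / 8.\<close>
  have m: "real n / 8 \<le> real m"
  proof -
    have "real (card W) \<le> 2 * real m + 1" unfolding m_def by linarith
    then show ?thesis using w n by linarith
  qed
  obtain A where A: "A \<subseteq> W" "card A = m"
    using obtain_subset_with_card_n[of m W] by (auto simp: m_def)
  define B where "B = W - A"
  have AB: "finite A" "finite B" "A \<inter> B = {}" "A \<union> B = W"
    using A finW by (auto simp: B_def intro: finite_subset)
  have "card B = card W - m" using A finW by (simp add: B_def card_Diff_subset finite_subset)
  then have "m \<le> card B" unfolding m_def by linarith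
  with m have B: "real n / 8 \<le> real (card B)" by linarith
  have sk: "0 < s ^ k" using s by simp
  have "s ^ k = (\<Prod>i\<in>{1..k}. s)" by simp
  also have "\<dots> \<le> \<sigma>"
    unfolding \<sigma>_def \<mu>_def type_pmf_collision[OF less_imp_le[OF p(1)] p(2)]
    using s by (intro prod_mono) (auto intro: less_imp_le)
  finally have \<sigma>: "s ^ k \<le> \<sigma>" .
  then have \<sigma>0: "0 < \<sigma>" using sk by linarith
  \<comment> \<open>The largest value meeting both conditions of
    \<open>expectation_mono_pairs_le\<close>. If the first one binds, l \<sigma> is at least n p s^k
    / (8 (1 + L)); otherwise l \<sigma> = sqrt \<sigma> \<ge> sqrt (s^k).\<close>
  define l where "l = min (real (card B) * p / (1 + L)) (1 / sqrt \<sigma>)"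
  have l0: "0 \<le> l" using p L \<sigma>0 by (auto simp: l_def)
  have "measure_pmf.expectation (Pi_pmf (A \<union> B) (\<lambda>_. False) (\<lambda>_. \<mu>)) (\<lambda>\<tau>. (1 - p) ^ card (mono_pairs (A \<union> B) \<tau>))
         \<le> exp (- (L\<^sup>2 / (4 * p))) + exp (- (real (card A) * l * \<sigma> / 2))"
  proof (rule expectation_mono_pairs_le[OF _ AB(1-3) p L \<sigma>_def l0])
    show "l \<le> real (card B) * p / (1 + L)" by (simp add: l_def)
    have "l * sqrt \<sigma> \<le> 1 / sqrt \<sigma> * sqrt \<sigma>"
      using \<sigma>0 by (intro mult_right_mono) (auto simp: l_def)
    then show "l * sqrt \<sigma> \<le> 1" using \<sigma>0 by simp
  qed (simp add: \<mu>_def finite_set_type_pmf)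
  also have "exp (- (real (card A) * l * \<sigma> / 2)) \<le>
      exp (- (real n / 16 * min (real n * p * s ^ k / (8 * (1 + L))) (sqrt (s ^ k))))"
  proof -
    let ?M = "min (real n * p * s ^ k / (8 * (1 + L))) (sqrt (s ^ k))"
    have "?M \<le> l * \<sigma>"
    proof (cases "real (card B) * p / (1 + L) \<le> 1 / sqrt \<sigma>")
      case True
      have "real n * p * s ^ k / (8 * (1 + L)) = (real n / 8) * (p / (1 + L)) * s ^ k"
        by simp
      also have "\<dots> \<le> real (card B) * (p / (1 + L)) * \<sigma>"
        using B \<sigma> p L sk by (intro mult_mono) auto
      also have "\<dots> = l * \<sigma>" using True by (simp add: l_def)
      finally show ?thesis by linarith
    next
      case False
      then have "l * \<sigma> = sqrt \<sigma>" using \<sigma>0 by (simp add: l_def real_div_sqrt)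
      then show ?thesis using \<sigma> by (simp add: min.coboundedI2)
    qed
    moreover have "0 \<le> ?M" using p L sk by simp
    ultimately have "real n / 8 * ?M \<le> real (card A) * (l * \<sigma>)"
      using m A(2) by (intro mult_mono) auto
    then show ?thesis by simp
  qed
  finally show "measure_pmf.expectation (Pi_pmf ({1..n} - S) (\<lambda>_. False) (\<lambda>_. type_pmf p S c k))
        (\<lambda>\<tau>. (1 - p) ^ card (mono_pairs ({1..n} - S) \<tau>)) \<le>
      exp (- (L\<^sup>2 / (4 * p))) +
       exp (- (real n / 16 * min (real n * p * s ^ k / (8 * (1 + L))) (sqrt (s ^ k))))"
    unfolding AB(4) \<mu>_def W_def by simp
qed

subsection \<open>Asymptotics\<close>

lemma aasI:
  assumes "\<forall>\<^sub>F n in sequentially. 1 - e n \<le> measure_pmf.prob (random_graph n (p n)) {G. P n G}"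
    and "e \<longlonglongrightarrow> 0"
  shows "aas p P"
  unfolding aas_def
proof (rule tendsto_sandwich)
  show "(\<lambda>n. 1 - e n) \<longlonglongrightarrow> 1" using tendsto_diff[OF tendsto_const assms(2), of 1] by simp
  show "\<forall>\<^sub>F n in sequentially. measure_pmf.prob (random_graph n (p n)) {G. P n G} \<le> 1" by simp
qed (use assms in auto)

lemma aas_mono:
  assumes "aas p P" "\<forall>\<^sub>F n in sequentially. \<forall>G. P n G \<longrightarrow> Q n G"
  shows "aas p Q"
proof (rule aasI[where e = "\<lambda>n. 1 - measure_pmf.prob (random_graph n (p n)) {G. P n G}"])
  show "\<forall>\<^sub>F n in sequentially. 1 - (1 - measure_pmf.prob (random_graph n (p n)) {G. P n G})
      \<le> measure_pmf.prob (random_graph n (p n)) {G. Q n G}"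
    using assms(2)
  proof eventually_elim
    case (elim n)
    have "measure_pmf.prob (random_graph n (p n)) {G. P n G} \<le> measure_pmf.prob (random_graph n (p n)) {G. Q n G}"
      using elim by (intro measure_pmf.finite_measure_mono) auto
    then show ?case by simp
  qed
  show "(\<lambda>n. 1 - measure_pmf.prob (random_graph n (p n)) {G. P n G}) \<longlonglongrightarrow> 0"
    using tendsto_diff[OF tendsto_const assms(1)[unfolded aas_def], of 1] by simp
qed

lemma aas_conj:
  assumes "aas p P" "aas p Q"
  shows "aas p (\<lambda>n G. P n G \<and> Q n G)"
proof (rule aasI)
  let ?D = "\<lambda>n. random_graph n (p n)"
  let ?e = "\<lambda>n. (1 - measure_pmf.prob (?D n) {G. P n G}) + (1 - measure_pmf.prob (?D n) {G. Q n G})"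
  show "\<forall>\<^sub>F n in sequentially. 1 - ?e n \<le> measure_pmf.prob (?D n) {G. P n G \<and> Q n G}"
  proof (intro always_eventually allI)
    fix n
    have "measure_pmf.prob (?D n) {G. \<not> (P n G \<and> Q n G)} \<le> measure_pmf.prob (?D n) ({G. \<not> P n G} \<union> {G. \<not> Q n G})"
      by (intro measure_pmf.finite_measure_mono) auto
    also have "\<dots> \<le> measure_pmf.prob (?D n) {G. \<not> P n G} + measure_pmf.prob (?D n) {G. \<not> Q n G}"
      by (rule measure_Un_le) auto
    finally show "1 - ?e n \<le> measure_pmf.prob (?D n) {G. P n G \<and> Q n G}"
      by (simp add: prob_not_pmf del: de_Morgan_conj)
  qed
  show "?e \<longlonglongrightarrow> 0"
    using tendsto_add[OF tendsto_diff[OF tendsto_const assms(1)[unfolded aas_def], of 1]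
        tendsto_diff[OF tendsto_const assms(2)[unfolded aas_def], of 1]] by simp
qed

text \<open>Turns a statement for every fixed \<delta> into one with an o(1) term: at stage n, use
  \<delta> = 1 / (j + 1) for the largest j whose probability has already come within 1 / (j + 1) of
  1 for good.\<close>

lemma aas_diagonal:
  assumes "\<And>\<delta>::real. 0 < \<delta> \<Longrightarrow> aas p (P \<delta>)"
  shows "\<exists>g. g \<in> o(\<lambda>_. 1) \<and> aas p (\<lambda>n. P (g n) n)"
proof -
  define a where "a = (\<lambda>j n. measure_pmf.prob (random_graph n (p n)) {G. P (1 / real (Suc j)) n G})"
  have "\<exists>N. \<forall>n\<ge>N. 1 - 1 / real (Suc j) < a j n" for j
  proof -
    have "a j \<longlonglongrightarrow> 1" using assms[of "1 / real (Suc j)"] by (simp add: aas_def a_def)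
    then have "\<forall>\<^sub>F n in sequentially. 1 - 1 / real (Suc j) < a j n"
      by (rule order_tendstoD(1)) simp
    then show ?thesis by (simp add: eventually_sequentially)
  qed
  then obtain N where N: "\<And>j n. N j \<le> n \<Longrightarrow> 1 - 1 / real (Suc j) < a j n" by metis
  \<comment> \<open>The cut-off \<open>j \<le> n\<close> keeps the set finite, and inserting 0 keeps
    it nonempty before any threshold is reached.\<close>
  define J where "J = (\<lambda>n. Max (insert 0 {j. j \<le> n \<and> N j \<le> n}))"
  have J_ge: "j \<le> J n" if "j \<le> n" "N j \<le> n" for j n
    unfolding J_def using that by (intro Max_ge) auto
  have J_N: "N (J n) \<le> n" if "N 0 \<le> n" for n
  proof -
    have "J n \<in> insert 0 {j. j \<le> n \<and> N j \<le> n}" unfolding J_def by (intro Max_in) auto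
    then show ?thesis using that by auto
  qed
  have J: "filterlim J at_top sequentially"
    unfolding filterlim_at_top eventually_sequentially
  proof
    fix Z show "\<exists>M. \<forall>n\<ge>M. Z \<le> J n"
      by (intro exI[of _ "max Z (N Z)"]) (auto intro: J_ge)
  qed
  define g where "g = (\<lambda>n. 1 / real (Suc (J n)))"
  have "(\<lambda>j. 1 / real (Suc j)) \<longlonglongrightarrow> 0" by real_asymp
  from filterlim_compose[OF this J] have g: "g \<longlonglongrightarrow> 0" by (simp add: g_def)
  have "aas p (\<lambda>n. P (g n) n)"
  proof (rule aasI[OF _ g])
    show "\<forall>\<^sub>F n in sequentially. 1 - g n \<le> measure_pmf.prob (random_graph n (p n)) {G. P (g n) n G}"
      using eventually_ge_at_top[of "N 0"]
    proof eventually_elim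
      case (elim n)
      from N[OF J_N[OF elim]] show ?case by (simp add: g_def a_def)
    qed
  qed
  moreover have "g \<in> o(\<lambda>_. 1)"
    using g by (intro smalloI_tendsto) auto
  ultimately show ?thesis by blast
qed

text \<open>Without a set colouring in k colours the set chromatic number is at least k + 1, which
  makes up for rounding when k is the floor of y.\<close>

lemma aas_le_set_chromatic_number:
  assumes "(\<lambda>n. measure_pmf.prob (random_graph n (p n)) {G. \<exists>c. set_colouring G (k n) c}) \<longlonglongrightarrow> 0"
    and "\<forall>\<^sub>F n in sequentially. y n \<le> real (k n) + 1"
  shows "aas p (\<lambda>n G. y n \<le> real (set_chromatic_number G))"
proof (rule aasI[OF _ assms(1)])
  show "\<forall>\<^sub>F n in sequentially.
      1 - measure_pmf.prob (random_graph n (p n)) {G. \<exists>c. set_colouring G (k n) c} \<le>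
      measure_pmf.prob (random_graph n (p n)) {G. y n \<le> real (set_chromatic_number G)}"
    using assms(2)
  proof eventually_elim
    case (elim n)
    let ?D = "random_graph n (p n)"
    have "y n \<le> real (set_chromatic_number G)"
      if "G \<in> set_pmf ?D" "\<not> (\<exists>c. set_colouring G (k n) c)" for G
    proof -
      have "simple_graph G" "finite (verts G)"
        using that(1) by (auto simp: random_graph_def simple_graph_def)
      then have "k n < set_chromatic_number G"
        using ex_set_colouring_of_ge[of G "k n"] that(2) by (meson not_le)
      then show ?thesis using elim by linarith
    qed
    then have "measure_pmf.prob ?D {G. \<not> (\<exists>c. set_colouring G (k n) c)} \<le>
        measure_pmf.prob ?D {G. y n \<le> real (set_chromatic_number G)}"
      by (intro measure_pmf.finite_measure_mono_AE AE_pmfI) auto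
    then show ?case by (simp add: prob_not_pmf del: not_ex)
  qed
qed

section \<open>Logarithmic upper and lower bounds\<close>

lemma powr_perturbation:
  fixes h :: "nat \<Rightarrow> real"
  assumes "h \<longlonglongrightarrow> 0" "0 < \<eta>"
  shows "\<forall>\<^sub>F n in sequentially. real n powr (\<alpha> - \<eta>) \<le> real n powr (\<alpha> + h n) \<and>
    real n powr (\<alpha> + h n) \<le> real n powr (\<alpha> + \<eta>)"
proof -
  have "\<forall>\<^sub>F n in sequentially. - \<eta> < h n" "\<forall>\<^sub>F n in sequentially. h n < \<eta>"
    using assms by (auto intro: order_tendstoD)
  then show ?thesis
    using eventually_ge_at_top[of 1] by eventually_elim (auto intro!: powr_mono)
qed

text \<open>With K about c lg n, the expected number of bad edges is at most n^b s^K up to a factor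
  n^o(1), about n^(b - c lg (1/s)), and the exponent is negative.\<close>

lemma aas_set_chromatic_number_le:
  fixes p :: "nat \<Rightarrow> real"
  assumes p: "\<forall>\<^sub>F n in sequentially. 0 \<le> p n \<and> p n \<le> 1"
    and h: "h \<longlonglongrightarrow> 0" "\<forall>\<^sub>F n in sequentially. (real n)\<^sup>2 * p n \<le> real n powr (b + h n)"
    and s: "(\<lambda>n. s_val (p n) (l n)) \<longlonglongrightarrow> s" "0 < s"
    and l: "\<forall>\<^sub>F n in sequentially. 1 \<le> l n" "\<forall>\<^sub>F n in sequentially. c * log 2 (real n) * real (l n) \<le> real n"
    and c: "0 < b" "0 < c" "b < c * log 2 (1 / s)"
  shows "aas p (\<lambda>n G. real (set_chromatic_number G) \<le> c * log 2 (real n))"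
proof -
  \<comment> \<open>A rate strictly below lg (1 / s) absorbs the convergence of
    \<open>s_val (p n) (l n)\<close> to s.\<close>
  obtain r where r: "b / c < r" and r': "r < log 2 (1 / s)"
    using dense[of "b / c" "log 2 (1 / s)"] c by (auto simp: pos_divide_less_eq mult.commute)
  have r0: "0 < r" using r c by (smt (verit) divide_pos_pos)
  have "s < 2 powr (- r)"
  proof -
    have "log 2 s < - r" using r' s(2) by (simp add: log_divide)
    then show ?thesis using s(2) by (simp add: log_less_iff)
  qed
  then have s': "\<forall>\<^sub>F n in sequentially. s_val (p n) (l n) < 2 powr (- r)"
    by (rule order_tendstoD(2)[OF s(1)])
  \<comment> \<open>Half of the surplus c r - b pays for the perturbation \<open>h\<close>; the
    other half is the decay rate of \<open>e\<close>.\<close>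
  define d where "d = (c * r - b) / 2"
  have d: "0 < d" using r c by (simp add: d_def field_simps)
  define e where "e = (\<lambda>n::nat. 2 powr (4 * r) * real n powr (- d))"
  have "\<forall>\<^sub>F n in sequentially. 4 \<le> c * log 2 (real n)"
    using c(2) by real_asymp
  then have "\<forall>\<^sub>F n in sequentially. 1 - e n \<le>
      measure_pmf.prob (random_graph n (p n)) {G. real (set_chromatic_number G) \<le> c * log 2 (real n)}"
    using p h(2) s' l powr_perturbation[OF h(1) d, of b] eventually_ge_at_top[of 1]
  proof eventually_elim
    case (elim n)
    define y where "y = c * log 2 (real n)"
    \<comment> \<open>The colouring uses K + 1 colours, hence the subtraction. Then K - 2 \<ge> y -
      4, which costs the factor 2^(4 r) in \<open>e\<close>.\<close>
    define K where "K = nat \<lfloor>y\<rfloor> - 1"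
    have y: "4 \<le> y" using elim by (simp add: y_def)
    have K: "real (K + 1) \<le> y" "y - 4 \<le> real (K - 2)"
      using y unfolding K_def by linarith+
    have "real (K * l n) \<le> y * real (l n)"
      using K(1) by (simp add: mult_right_mono)
    also have "\<dots> \<le> real n" using elim by (simp add: y_def)
    finally have Kl: "K * l n \<le> n" by linarith
    have "(2 powr (- r)) ^ (K - 2) = 2 powr (- r * real (K - 2))"
      by (simp add: powr_realpow[symmetric] powr_powr)
    also have "\<dots> \<le> 2 powr (- r * (y - 4))"
      using K(2) r0 by (intro powr_mono) auto
    also have "2 powr (- r * (y - 4)) = 2 powr (4 * r) * real n powr (- r * c)"
    proof -
      have "real n powr (- r * c) = 2 powr (log 2 (real n) * (- r * c))"
        using elim unfolding powr_powr[symmetric] by (subst powr_log_cancel) auto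
      then show ?thesis by (simp add: y_def powr_add[symmetric] algebra_simps)
    qed
    finally have rK: "(2 powr (- r)) ^ (K - 2) \<le> 2 powr (4 * r) * real n powr (- r * c)" .
    have "(real n)\<^sup>2 * p n * s_val (p n) (l n) ^ (K - 2) \<le> real n powr (b + d) * (2 powr (- r)) ^ (K - 2)"
      using elim s_val_bounds[of "p n" "l n"] by (intro mult_mono power_mono) auto
    also have "\<dots> \<le> real n powr (b + d) * (2 powr (4 * r) * real n powr (- r * c))"
      by (rule mult_left_mono[OF rK]) simp
    also have "real n powr (b + d) * (2 powr (4 * r) * real n powr (- r * c)) = e n"
    proof -
      have "b + d + - r * c = - d" by (simp add: d_def field_simps)
      then have "real n powr (b + d) * real n powr (- r * c) = real n powr (- d)"
        by (metis powr_add)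
      then show ?thesis by (simp add: e_def)
    qed
    finally have "1 - e n \<le> 1 - (real n)\<^sup>2 * p n * s_val (p n) (l n) ^ (K - 2)"
      by simp
    also have "\<dots> \<le> measure_pmf.prob (random_graph n (p n)) {G. set_chromatic_number G \<le> K + 1}"
      using elim Kl by (intro prob_chromatic_le) auto
    also have "\<dots> \<le> measure_pmf.prob (random_graph n (p n)) {G. real (set_chromatic_number G) \<le> c * log 2 (real n)}"
    proof (rule measure_pmf.finite_measure_mono)
      have "real m \<le> y" if "m \<le> K + 1" for m
        using that K(1) by linarith
      then show "{G. set_chromatic_number G \<le> K + 1} \<subseteq> {G. real (set_chromatic_number G) \<le> c * log 2 (real n)}"
        unfolding y_def by blast
    qed simp
    finally show ?case .
  qed
  moreover have "e \<longlonglongrightarrow> 0"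
    unfolding e_def using d by real_asymp
  ultimately show ?thesis by (rule aasI)
qed

text \<open>With k about c lg n, the union bound costs exponent k (ln n)^2 / p = n^(1 - \<alpha> +
  o(1)), while the gain n^2 p s^k is n^(1 + \<alpha> - c lg (1/s) + o(1)); the gain dominates
  exactly when c lg (1/s) < 2 \<alpha>.\<close>

lemma aas_le_set_chromatic_number_log:
  fixes p :: "nat \<Rightarrow> real"
  assumes p: "\<forall>\<^sub>F n in sequentially. 0 < p n \<and> p n \<le> 1"
    and \<alpha>: "0 < \<alpha>" "\<alpha> \<le> 1"
    and h: "h \<longlonglongrightarrow> 0" "\<forall>\<^sub>F n in sequentially. real n * p n = real n powr (\<alpha> + h n)"
    and s: "0 < s" "s < 1" "\<forall>\<^sub>F n in sequentially. \<forall>l. s \<le> s_val (p n) l"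
    and c: "c * log 2 (1 / s) < 2 * \<alpha>"
  shows "aas p (\<lambda>n G. c * log 2 (real n) \<le> real (set_chromatic_number G))"
proof (cases "c \<le> 0")
  case True
  have "\<forall>\<^sub>F n in sequentially. c * log 2 (real n) \<le> 0"
    using eventually_ge_at_top[of 1] by eventually_elim (auto intro!: mult_nonpos_nonneg simp: True)
  then have "\<forall>\<^sub>F n in sequentially. \<forall>G :: nat ugraph. True \<longrightarrow> c * log 2 (real n) \<le> real (set_chromatic_number G)"
    by eventually_elim (auto intro: order_trans)
  moreover have "aas p (\<lambda>_ _. True)" by (simp add: aas_def)
  ultimately show ?thesis by (rule aas_mono[rotated])
next
  case False
  then have c0: "0 < c" by simp
  \<comment> \<open>Each estimate loses a few factors n^\<eta>. A margin of 16 \<eta> leaves the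
    gain at least n^(5 \<eta>) times the cost, up to a constant, and \<eta> \<le> \<alpha> / 2 keeps
    n^(\<alpha> - \<eta>) growing.\<close>
  define \<eta> where "\<eta> = min ((2 * \<alpha> - c * log 2 (1 / s)) / 16) (\<alpha> / 2)"
  have \<eta>: "0 < \<eta>" "16 * \<eta> \<le> 2 * \<alpha> - c * log 2 (1 / s)" "\<eta> \<le> \<alpha> / 2"
  proof -
    define z where "z = 2 * \<alpha> - c * log 2 (1 / s)"
    have "0 < z" using c unfolding z_def by linarith
    then show "0 < \<eta>" "16 * \<eta> \<le> 2 * \<alpha> - c * log 2 (1 / s)" "\<eta> \<le> \<alpha> / 2"
      using \<alpha> unfolding \<eta>_def z_def[symmetric] min_def by auto
  qed
  define k where "k = (\<lambda>n::nat. nat \<lfloor>c * log 2 (real n)\<rfloor>)"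
  define e where "e = (\<lambda>n::nat. 1 / real n + 2 * exp (real n powr (1 - \<alpha> + 2 * \<eta>) - real n powr (1 - \<alpha> + 7 * \<eta>) / 256))"
  have "e \<longlonglongrightarrow> 0"
  proof -
    define a where "a = 1 - \<alpha> + 2 * \<eta>"
    have "0 < a" using \<alpha> \<eta> by (simp add: a_def)
    moreover have "1 - \<alpha> + 7 * \<eta> = a + 5 * \<eta>" by (simp add: a_def)
    ultimately show ?thesis
      using \<eta>(1) unfolding e_def a_def[symmetric] by (simp only:) real_asymp
  qed
  have ev1: "\<forall>\<^sub>F n in sequentially. 16 * (c * log 2 (real n)) * (ln (real n))\<^sup>2 \<le> real n powr \<eta>"
    using c0 \<eta>(1) by real_asymp
  have ev2: "\<forall>\<^sub>F n in sequentially. 16 * (c * log 2 (real n)) * ln (real n) \<le> real n powr (\<alpha> - \<eta>)"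
  proof -
    have "0 < \<alpha> - \<eta>" using \<eta> \<alpha> by simp
    then show ?thesis using c0 by real_asymp
  qed
  have ev3: "\<forall>\<^sub>F n in sequentially. 2 \<le> real n powr (4 * \<eta>)"
    using \<eta>(1) by real_asymp
  have ev4: "\<forall>\<^sub>F n in sequentially. c * log 2 (real n) \<le> real n"
    using c0 by real_asymp
  have main: "\<forall>\<^sub>F n in sequentially.
      measure_pmf.prob (random_graph n (p n)) {G. \<exists>c. set_colouring G (k n) c} \<le> e n"
    using p h(2) s(3) powr_perturbation[OF h(1) \<eta>(1), of \<alpha>] ev1 ev2 ev3 ev4 eventually_ge_at_top[of 4]
  proof eventually_elim
    case (elim n)
    define x where "x = real n"
    have x: "4 \<le> x" using elim by (simp add: x_def)
    have pn: "0 < p n" "p n \<le> 1" using elim by auto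
    have xp: "x powr (\<alpha> - \<eta>) \<le> x * p n" "x * p n \<le> x powr (\<alpha> + \<eta>)"
      using elim by (auto simp: x_def)
    have ip: "x powr (1 - \<alpha> - \<eta>) \<le> 1 / p n" "1 / p n \<le> x powr (1 - \<alpha> + \<eta>)"
    proof -
      have p1: "1 / p n = x / (x * p n)" using x by simp
      have pos: "0 < x * p n" "0 < x powr (\<alpha> - \<eta>)" "0 < x powr (\<alpha> + \<eta>)" using x pn by auto
      have "x powr (1 - \<alpha> - \<eta>) = x powr 1 / x powr (\<alpha> + \<eta>)"
        unfolding powr_diff[symmetric] by (simp add: algebra_simps)
      also have "\<dots> \<le> x / (x * p n)"
        using divide_left_mono[OF xp(2), of x] pos x by simp
      finally show "x powr (1 - \<alpha> - \<eta>) \<le> 1 / p n" unfolding p1 .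
      have "x / (x * p n) \<le> x powr 1 / x powr (\<alpha> - \<eta>)"
        using divide_left_mono[OF xp(1), of x] pos x by simp
      also have "\<dots> = x powr (1 - \<alpha> + \<eta>)"
        unfolding powr_diff[symmetric] by (simp add: algebra_simps)
      finally show "1 / p n \<le> x powr (1 - \<alpha> + \<eta>)" unfolding p1 .
    qed
    have y0: "0 \<le> c * log 2 x" using c0 x by simp
    have ky: "real (k n) \<le> c * log 2 x" using y0 by (simp add: k_def x_def)
    have lnx: "0 \<le> ln x" using x by simp
    have "16 * real (k n) * ln x \<le> 16 * (c * log 2 x) * ln x"
      using ky lnx by (intro mult_right_mono) auto
    also have "\<dots> \<le> x powr (\<alpha> - \<eta>)" using elim by (simp add: x_def)
    also have "\<dots> \<le> x * p n" by (rule xp(1))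
    finally have size: "16 * real (k n) * ln (real n) \<le> real n * p n" by (simp add: x_def)
    have kn: "k n \<le> n" using ky elim by (simp add: x_def)
    \<comment> \<open>A compromise: L^2 / p must beat the union bound, but L also divides the second
      gain. The three gains below reach exponents 1 - \<alpha> plus 7 \<eta>, 11 \<eta> and 8
      \<eta>, against a cost of 1 - \<alpha> + 2 \<eta>.\<close>
    define L where "L = x powr (4 * \<eta>)"
    have L: "2 \<le> L" using elim by (simp add: L_def x_def)
    have sn: "\<And>l. s \<le> s_val (p n) l" using elim by blast
    have sk: "x powr (- 2 * \<alpha> + 16 * \<eta>) \<le> s ^ k n"
    proof -
      have "x powr (- 2 * \<alpha> + 16 * \<eta>) \<le> x powr (- (c * log 2 (1 / s)))"
        using \<eta>(2) x by (intro powr_mono) auto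
      also have "\<dots> = s powr (c * log 2 x)"
        using s(1) x by (simp add: powr_def log_def ln_div)
      also have "\<dots> \<le> s powr real (k n)"
        using ky s by (intro powr_mono') auto
      finally show ?thesis using s(1) by (simp add: powr_realpow)
    qed
    \<comment> \<open>Common lower bound for all three gains; 256 is 16 from n / 16 times 16 from 8
      (1 + L) \<le> 16 L.\<close>
    define Z where "Z = x powr (1 - \<alpha> + 7 * \<eta>) / 256"
    have E1: "16 * real (k n) * (ln (real n))\<^sup>2 / p n \<le> x powr (1 - \<alpha> + 2 * \<eta>)"
    proof -
      have "16 * real (k n) * (ln x)\<^sup>2 \<le> 16 * (c * log 2 x) * (ln x)\<^sup>2"
        using ky by (intro mult_right_mono) auto
      also have "\<dots> \<le> x powr \<eta>" using elim by (simp add: x_def)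
      finally have "16 * real (k n) * (ln x)\<^sup>2 * (1 / p n) \<le> x powr \<eta> * x powr (1 - \<alpha> + \<eta>)"
        using ip(2) pn by (intro mult_mono) auto
      also have "\<dots> = x powr (1 - \<alpha> + 2 * \<eta>)"
        unfolding powr_add[symmetric] by (simp add: algebra_simps)
      finally show ?thesis by (simp add: x_def)
    qed
    have E2: "Z \<le> L\<^sup>2 / (4 * p n)"
    proof -
      have "L\<^sup>2 = x powr (8 * \<eta>)"
        by (simp add: L_def power2_eq_square powr_add[symmetric])
      then have "x powr (8 * \<eta>) * x powr (1 - \<alpha> - \<eta>) \<le> L\<^sup>2 * (1 / p n)"
        using mult_left_mono[OF ip(1), of "x powr (8 * \<eta>)"] by simp
      also have "x powr (8 * \<eta>) * x powr (1 - \<alpha> - \<eta>) = x powr (1 - \<alpha> + 7 * \<eta>)"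
        unfolding powr_add[symmetric] by (simp add: algebra_simps)
      finally have "x powr (1 - \<alpha> + 7 * \<eta>) / 4 \<le> L\<^sup>2 / (4 * p n)" by simp
      moreover have "Z \<le> x powr (1 - \<alpha> + 7 * \<eta>) / 4" by (simp add: Z_def)
      ultimately show ?thesis by linarith
    qed
    have mono: "x powr a \<le> x powr b" if "a \<le> b" for a b
      using that x by (intro powr_mono) auto
    have E3: "Z \<le> x / 16 * (x * p n * s ^ k n / (8 * (1 + L)))"
    proof -
      have "x powr (\<alpha> - \<eta>) * x powr (- 2 * \<alpha> + 16 * \<eta>) \<le> x * p n * s ^ k n"
        using xp(1) sk pn x by (intro mult_mono) auto
      then have "x powr (15 * \<eta> - \<alpha>) \<le> x * p n * s ^ k n"
        by (simp add: powr_add[symmetric] algebra_simps)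
      moreover have "8 * (1 + L) \<le> 16 * L" using L by simp
      ultimately have "x powr (15 * \<eta> - \<alpha>) / (16 * L) \<le> x * p n * s ^ k n / (8 * (1 + L))"
        using L x pn s by (intro frac_le) auto
      then have "x / 16 * (x powr (15 * \<eta> - \<alpha>) / (16 * L)) \<le> x / 16 * (x * p n * s ^ k n / (8 * (1 + L)))"
        using x by (intro mult_left_mono) auto
      moreover have "x / 16 * (x powr (15 * \<eta> - \<alpha>) / (16 * L)) = x powr (1 - \<alpha> + 11 * \<eta>) / 256"
      proof -
        have "x powr (1 - \<alpha> + 11 * \<eta>) = x powr 1 * x powr (15 * \<eta> - \<alpha>) / x powr (4 * \<eta>)"
          unfolding powr_add[symmetric] powr_diff[symmetric] by (simp add: algebra_simps)
        then show ?thesis using x by (simp add: L_def)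
      qed
      moreover have "Z \<le> x powr (1 - \<alpha> + 11 * \<eta>) / 256"
        unfolding Z_def using \<eta>(1) by (intro divide_right_mono mono) auto
      ultimately show ?thesis by linarith
    qed
    have E4: "Z \<le> x / 16 * sqrt (s ^ k n)"
    proof -
      have "sqrt (x powr (- 2 * \<alpha> + 16 * \<eta>)) = x powr (- \<alpha> + 8 * \<eta>)"
        using x by (simp add: powr_half_sqrt[symmetric] powr_powr algebra_simps)
      then have "x powr (- \<alpha> + 8 * \<eta>) \<le> sqrt (s ^ k n)" using sk by (metis real_sqrt_le_iff)
      then have "x / 16 * x powr (- \<alpha> + 8 * \<eta>) \<le> x / 16 * sqrt (s ^ k n)"
        using x by (intro mult_left_mono) auto
      moreover have "x powr (1 - \<alpha> + 8 * \<eta>) = x powr 1 * x powr (- \<alpha> + 8 * \<eta>)"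
        unfolding powr_add[symmetric] by (simp add: algebra_simps)
      then have "x / 16 * x powr (- \<alpha> + 8 * \<eta>) = x powr (1 - \<alpha> + 8 * \<eta>) / 16"
        using x by simp
      moreover have "x powr (1 - \<alpha> + 7 * \<eta>) \<le> x powr (1 - \<alpha> + 8 * \<eta>)"
        using \<eta>(1) by (intro mono) auto
      moreover have "0 \<le> x powr (1 - \<alpha> + 7 * \<eta>)" by simp
      ultimately show ?thesis unfolding Z_def by linarith
    qed
    have "measure_pmf.prob (random_graph n (p n)) {G. \<exists>c. set_colouring G (k n) c} \<le>
      1 / real n + exp (16 * real (k n) * (ln (real n))\<^sup>2 / p n) *
      (exp (- (L\<^sup>2 / (4 * p n))) +
       exp (- (real n / 16 * min (real n * p n * s ^ k n / (8 * (1 + L))) (sqrt (s ^ k n)))))"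
      using elim by (intro prob_set_colourable_le_random_types[OF _ pn kn size s(1) sn L]) auto
    also have "\<dots> \<le> 1 / real n + exp (x powr (1 - \<alpha> + 2 * \<eta>)) * (exp (- Z) + exp (- Z))"
    proof -
      have "Z \<le> real n / 16 * min (real n * p n * s ^ k n / (8 * (1 + L))) (sqrt (s ^ k n))"
        using E3 E4 unfolding min_def x_def[symmetric] by presburger
      then show ?thesis
        using E1 E2 by (intro add_mono mult_mono) auto
    qed
    also have "\<dots> = 1 / x + 2 * exp (x powr (1 - \<alpha> + 2 * \<eta>) + - Z)"
      unfolding exp_add by (simp add: x_def)
    also have "\<dots> = e n" by (simp add: e_def Z_def x_def)
    finally show ?case .
  qed
  have "(\<lambda>n. measure_pmf.prob (random_graph n (p n)) {G. \<exists>c. set_colouring G (k n) c}) \<longlonglongrightarrow> 0"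
    by (rule tendsto_sandwich[OF _ main tendsto_const \<open>e \<longlonglongrightarrow> 0\<close>]) simp
  then show ?thesis
    by (rule aas_le_set_chromatic_number) (intro always_eventually allI, unfold k_def, linarith)
qed

subsection \<open>The sparse, very sparse and dense regimes\<close>

text \<open>For the last l with (1 - p)^l \<ge> 1/2, one more factor drops below 1/2, so (1 - p)^l
  exceeds 1/2 by at most p, and \<open>s_val\<close> exceeds 1/2 by twice the square of that. The
  size bound follows from 1 + p l \<le> exp (p l) \<le> 2.\<close>

lemma ex_s_val_near_half:
  assumes p: "0 < p" "p \<le> 1 / 2"
  shows "\<exists>l\<ge>1. real l \<le> 1 / p \<and> s_val p l \<le> 1 / 2 + 2 * p\<^sup>2"
proof -
  \<comment> \<open>The shift by \<open>Suc\<close> makes the least such m the last exponent before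
    the crossing; it is nonzero because 1 - p \<ge> 1/2.\<close>
  define P where "P = (\<lambda>m. (1 - p) ^ Suc m < 1 / 2)"
  have "\<exists>m. (1 - p) ^ m < 1 / 2" using p by (intro real_arch_pow_inv) auto
  then obtain m where "(1 - p) ^ m < 1 / 2" by blast
  moreover have "(1 - p) ^ Suc m \<le> (1 - p) ^ m" using p by (intro power_decreasing) auto
  ultimately have Pm: "P m" unfolding P_def by linarith
  define l where "l = (LEAST m. P m)"
  have Pl: "P l" unfolding l_def using Pm by (rule LeastI)
  have "l \<noteq> 0"
  proof
    assume "l = 0"
    then show False using Pl p by (simp add: P_def)
  qed
  then have l1: "1 \<le> l" by simp
  have "\<not> P (l - 1)" using l1 unfolding l_def by (intro not_less_Least) auto
  then have q: "1 / 2 \<le> (1 - p) ^ l" using l1 by (simp add: P_def del: power_Suc)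
  define q' where "q' = (1 - p) ^ l"
  have q': "1 / 2 \<le> q'" "q' \<le> 1" "q' - q' * p < 1 / 2"
    using q Pl p by (auto simp: q'_def P_def power_le_one algebra_simps)
  have "q' * p \<le> 1 * p" using q' p by (intro mult_right_mono) auto
  then have "q' - 1 / 2 \<le> p" using q' by linarith
  then have "(q' - 1 / 2)\<^sup>2 \<le> p\<^sup>2" using q' by (intro power_mono) auto
  then have "q'\<^sup>2 + (1 - q')\<^sup>2 \<le> 1 / 2 + 2 * p\<^sup>2"
    by (simp add: power2_eq_square algebra_simps)
  then have s: "s_val p l \<le> 1 / 2 + 2 * p\<^sup>2" by (simp add: s_val_def q'_def)
  have "1 / 2 \<le> exp (- (p * real l))"
    using q one_minus_power_le_exp[of p l] p by linarith
  then have "exp (p * real l) \<le> 2" by (simp add: exp_minus field_simps)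
  then have "p * real l \<le> 1" using exp_ge_add_one_self[of "p * real l"] by linarith
  then have "real l \<le> 1 / p" using p by (simp add: field_simps)
  with s l1 show ?thesis by blast
qed

text \<open>Class sizes from \<open>ex_s_val_near_half\<close> make s = 1/2 and lg (1/s) = 1, so
  every constant above 1 + \<alpha> suffices; \<open>dense\<close> ensures that the classes, of size
  at most 1 / p, fit into n vertices. It allows \<alpha> = 0 so as to cover the very sparse regime
  too.\<close>

lemma aas_set_chromatic_number_le_sparse:
  fixes p :: "nat \<Rightarrow> real"
  assumes p: "\<forall>\<^sub>F n in sequentially. 0 < p n" "p \<longlonglongrightarrow> 0"
    and h: "h \<longlonglongrightarrow> 0" "\<forall>\<^sub>F n in sequentially. real n * p n = real n powr (\<alpha> + h n)"
    and \<alpha>: "0 \<le> \<alpha>" "0 < \<delta>"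
    and dense: "\<forall>\<^sub>F n in sequentially. (1 + \<alpha> + \<delta>) * log 2 (real n) \<le> real n * p n"
  shows "aas p (\<lambda>n G. real (set_chromatic_number G) \<le> (1 + \<alpha> + \<delta>) * log 2 (real n))"
proof -
  have small: "\<forall>\<^sub>F n in sequentially. p n < 1 / 2"
    by (rule order_tendstoD(2)[OF p(2)]) simp
  define l where "l = (\<lambda>n. SOME l. l \<ge> 1 \<and> real l \<le> 1 / p n \<and> s_val (p n) l \<le> 1 / 2 + 2 * (p n)\<^sup>2)"
  have l: "\<forall>\<^sub>F n in sequentially. l n \<ge> 1 \<and> real (l n) \<le> 1 / p n \<and> s_val (p n) (l n) \<le> 1 / 2 + 2 * (p n)\<^sup>2"
    using p(1) small
  proof eventually_elim
    case (elim n)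
    then have "\<exists>l. l \<ge> 1 \<and> real l \<le> 1 / p n \<and> s_val (p n) l \<le> 1 / 2 + 2 * (p n)\<^sup>2"
      using ex_s_val_near_half[of "p n"] by auto
    then show ?case unfolding l_def by (rule someI_ex)
  qed
  show ?thesis
  proof (rule aas_set_chromatic_number_le[OF _ h(1), where b = "1 + \<alpha>" and s = "1 / 2" and l = l])
    show "\<forall>\<^sub>F n in sequentially. 0 \<le> p n \<and> p n \<le> 1"
      using p(1) small by eventually_elim auto
    show "\<forall>\<^sub>F n in sequentially. (real n)\<^sup>2 * p n \<le> real n powr (1 + \<alpha> + h n)"
      using h(2) eventually_gt_at_top[of 0]
    proof eventually_elim
      case (elim n)
      have "real n powr (1 + \<alpha> + h n) = real n powr 1 * real n powr (\<alpha> + h n)"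
        unfolding powr_add[symmetric] by (simp add: algebra_simps)
      also have "\<dots> = (real n)\<^sup>2 * p n"
        using elim by (simp add: power2_eq_square)
      finally show ?case by simp
    qed
    have "(\<lambda>n. 1 / 2 + 2 * (p n)\<^sup>2) \<longlonglongrightarrow> 1 / 2 + 2 * 0\<^sup>2"
      by (intro tendsto_intros p(2))
    then have lim: "(\<lambda>n. 1 / 2 + 2 * (p n)\<^sup>2) \<longlonglongrightarrow> 1 / 2" by simp
    show "(\<lambda>n. s_val (p n) (l n)) \<longlonglongrightarrow> 1 / 2"
    proof (rule tendsto_sandwich[OF _ _ tendsto_const lim])
      show "\<forall>\<^sub>F n in sequentially. 1 / 2 \<le> s_val (p n) (l n)"
        using p(1) small by eventually_elim (intro s_val_bounds, auto)
      show "\<forall>\<^sub>F n in sequentially. s_val (p n) (l n) \<le> 1 / 2 + 2 * (p n)\<^sup>2"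
        using l by eventually_elim auto
    qed
    show "\<forall>\<^sub>F n in sequentially. 1 \<le> l n" using l by eventually_elim auto
    show "\<forall>\<^sub>F n in sequentially. (1 + \<alpha> + \<delta>) * log 2 (real n) * real (l n) \<le> real n"
      using l dense p(1)
    proof eventually_elim
      case (elim n)
      have "(1 + \<alpha> + \<delta>) * log 2 (real n) * real (l n) \<le> (real n * p n) * (1 / p n)"
        using elim by (intro mult_mono[of "(1 + \<alpha> + \<delta>) * log 2 (real n)"]) auto
      then show ?case using elim by simp
    qed
  qed (use \<alpha> in auto)
qed

text \<open>Here 2^k \<le> w^2 with w = n p / (x z), x = ln n and z = ln (n p), so counting types is
  enough: the gain p n^2 / (16 w^2) equals x^2 z^2 / (16 p), against a cost of at most 48 z x^2 /
  p.\<close>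

lemma aas_le_set_chromatic_number_very_sparse:
  fixes p :: "nat \<Rightarrow> real"
  assumes p: "\<forall>\<^sub>F n in sequentially. 0 < p n \<and> p n \<le> 1"
    and h: "h \<longlonglongrightarrow> 0" "\<forall>\<^sub>F n in sequentially. real n * p n = real n powr h n"
    and lim: "filterlim (\<lambda>n. real n * p n) at_top sequentially"
    and dense: "\<forall>\<^sub>F n in sequentially. (ln (real n))\<^sup>2 * (ln (real n * p n))\<^sup>2 \<le> real n * p n"
  shows "aas p (\<lambda>n G. 2 * (log 2 (real n * p n) - log 2 (ln (real n)) - log 2 (ln (real n * p n)))
    \<le> real (set_chromatic_number G))"
proof -
  define y where "y = (\<lambda>n. 2 * (log 2 (real n * p n) - log 2 (ln (real n)) - log 2 (ln (real n * p n))))"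
  define k where "k = (\<lambda>n. nat \<lfloor>y n\<rfloor>)"
  \<comment> \<open>Since 800 / 16 = 50, the gain is at least 50 z x^2 / p, leaving a surplus of 2 z
    x^2 / p over the cost.\<close>
  have ev1: "\<forall>\<^sub>F n in sequentially. 800 \<le> ln (real n * p n)"
    using filterlim_compose[OF ln_at_top lim] by (simp add: filterlim_at_top)
  \<comment> \<open>Gives n p \<le> n^(1/4), so 2^k \<le> w^2 \<le> (n p)^2 \<le> n^(1/2) \<le> n /
    4.\<close>
  have ev2: "\<forall>\<^sub>F n in sequentially. h n < 1 / 4"
    by (rule order_tendstoD(2)[OF h(1)]) simp
  have ev3: "\<forall>\<^sub>F n::nat in sequentially. 4 * real n powr (1 / 2) \<le> real n" by real_asymp
  have ev4: "\<forall>\<^sub>F n::nat in sequentially. 1 \<le> ln (real n)" by real_asymp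
  have main: "\<forall>\<^sub>F n in sequentially.
      measure_pmf.prob (random_graph n (p n)) {G. \<exists>c. set_colouring G (k n) c} \<le> 2 / real n"
    using p h(2) dense ev1 ev2 ev3 ev4 eventually_ge_at_top[of 3]
  proof eventually_elim
    case (elim n)
    define x where "x = ln (real n)"
    define z where "z = ln (real n * p n)"
    define X where "X = real n * p n"
    have x: "1 \<le> x" and z: "800 \<le> z" using elim by (auto simp: x_def z_def)
    have pn: "0 < p n" "p n \<le> 1" using elim by auto
    have n0: "3 \<le> real n" using elim by simp
    have X0: "0 < X" using pn n0 by (simp add: X_def)
    have xz: "800 \<le> x * z" using mult_mono[of 1 x 800 z] x z by simp
    have X: "x\<^sup>2 * z\<^sup>2 \<le> X" using elim by (simp add: x_def z_def X_def)
    have z_ln: "z = ln X" by (simp add: z_def X_def)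
    have xzX: "48 * (x * z) \<le> X"
    proof -
      have "48 * (x * z) \<le> (x * z) * (x * z)" using xz by (intro mult_right_mono) auto
      then show ?thesis using X by (simp add: power2_eq_square mult_ac)
    qed
    have Xn: "X \<le> real n" using pn n0 by (simp add: X_def mult_left_le)
    define w where "w = X / (x * z)"
    have w: "1 \<le> w" "w \<le> X"
    proof -
      show "1 \<le> w" using xzX xz by (simp add: w_def)
      have "X / (x * z) \<le> X / 1" using xz X0 by (intro divide_left_mono) auto
      then show "w \<le> X" by (simp add: w_def)
    qed
    have yw: "y n = 2 * log 2 w"
    proof -
      have "log 2 w = log 2 X - (log 2 x + log 2 z)"
        unfolding w_def using X0 x z by (simp add: log_divide log_mult)
      then show ?thesis unfolding y_def X_def[symmetric] x_def[symmetric] z_ln[symmetric] by simp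
    qed
    have y0: "0 \<le> y n" using w by (simp add: yw)
    have ky: "real (k n) \<le> y n" using y0 by (simp add: k_def)
    have "y n \<le> 2 * log 2 X" using w X0 by (simp add: yw)
    also have "2 * log 2 X = 2 * z / ln 2" by (simp add: log_def z_ln)
    also have "\<dots> \<le> 2 * z / (2 / 3)"
      using z ln2_ge_two_thirds by (intro divide_left_mono) auto
    finally have kz: "real (k n) \<le> 3 * z" using ky by simp
    have "2 ^ k n = 2 powr real (k n)" by (simp add: powr_realpow)
    also have "\<dots> \<le> 2 powr (2 * log 2 w)" using ky by (simp add: yw)
    also have "\<dots> = w\<^sup>2"
    proof -
      have "2 powr (2 * log 2 w) = 2 powr (log 2 w + log 2 w)" by simp
      also have "\<dots> = w * w" unfolding powr_add using w by simp
      finally show ?thesis by (simp add: power2_eq_square)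
    qed
    finally have k2: "2 ^ k n \<le> w\<^sup>2" .
    have size: "16 * real (k n) * ln (real n) \<le> real n * p n"
    proof -
      have "16 * real (k n) * x \<le> 16 * (3 * z) * x"
        using kz x by (intro mult_right_mono) auto
      also have "\<dots> = 48 * (x * z)" by simp
      also note xzX
      finally show ?thesis by (simp add: x_def X_def)
    qed
    have kn: "k n \<le> n"
    proof -
      have "real (k n) * 1 \<le> real (k n) * x" using x by (intro mult_left_mono) auto
      then have "real (k n) \<le> real n"
        using size Xn by (simp add: x_def X_def)
      then show ?thesis by simp
    qed
    have types: "4 * 2 ^ k n \<le> real n"
    proof -
      have "w\<^sup>2 \<le> X\<^sup>2" using w by (intro power_mono) auto
      also have "X \<le> real n powr (1 / 4)"
        using elim n0 by (simp add: X_def)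
      then have "X\<^sup>2 \<le> (real n powr (1 / 4))\<^sup>2" using X0 by (intro power_mono) auto
      also have "(real n powr (1 / 4))\<^sup>2 = real n powr (1 / 2)"
        by (simp add: power2_eq_square powr_add[symmetric])
      finally show ?thesis using k2 elim by linarith
    qed
    have "measure_pmf.prob (random_graph n (p n)) {G. \<exists>c. set_colouring G (k n) c} \<le>
        1 / real n + exp (16 * real (k n) * (ln (real n))\<^sup>2 / p n) *
        exp (- (p n * (real n)\<^sup>2 / (16 * 2 ^ k n)))"
      using elim by (intro prob_set_colourable_le_few_types pn kn size types) auto
    also have "exp (16 * real (k n) * (ln (real n))\<^sup>2 / p n) * exp (- (p n * (real n)\<^sup>2 / (16 * 2 ^ k n))) \<le> 1 / real n"
    proof -
      have A: "16 * real (k n) * x\<^sup>2 / p n \<le> 48 * z * x\<^sup>2 / p n"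
        using kz pn by (intro divide_right_mono mult_right_mono) auto
      have "p n * (real n)\<^sup>2 / (16 * w\<^sup>2) \<le> p n * (real n)\<^sup>2 / (16 * 2 ^ k n)"
        using k2 pn w by (intro divide_left_mono mult_left_mono) auto
      moreover have "p n * (real n)\<^sup>2 / (16 * w\<^sup>2) = (z / 16) * z * x\<^sup>2 / p n"
        using pn n0 x z by (simp add: w_def X_def power2_eq_square field_simps)
      moreover have "50 * z * x\<^sup>2 / p n \<le> (z / 16) * z * x\<^sup>2 / p n"
        using z pn by (intro divide_right_mono mult_right_mono) auto
      ultimately have B: "50 * z * x\<^sup>2 / p n \<le> p n * (real n)\<^sup>2 / (16 * 2 ^ k n)" by linarith
      have "x * 1 \<le> x * (z * x)" using x xz by (intro mult_left_mono) (auto simp: mult.commute)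
      then have "x \<le> z * x\<^sup>2" by (simp add: power2_eq_square mult_ac)
      also have "\<dots> \<le> z * x\<^sup>2 / p n" using pn z by (simp add: pos_le_divide_eq mult_left_le)
      finally have "x \<le> z * x\<^sup>2 / p n" .
      then have "16 * real (k n) * x\<^sup>2 / p n + - (p n * (real n)\<^sup>2 / (16 * 2 ^ k n)) \<le> - x"
      proof -
        define t where "t = z * x\<^sup>2 / p n"
        define u where "u = 16 * real (k n) * x\<^sup>2 / p n"
        define v where "v = p n * (real n)\<^sup>2 / (16 * 2 ^ k n)"
        have "u \<le> 48 * t" "50 * t \<le> v" using A B by (simp_all add: t_def u_def v_def)
        with \<open>x \<le> z * x\<^sup>2 / p n\<close> x have "u + - v \<le> - x" unfolding t_def[symmetric] by linarith
        then show ?thesis by (simp only: u_def v_def)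
      qed
      then have "exp (16 * real (k n) * x\<^sup>2 / p n + - (p n * (real n)\<^sup>2 / (16 * 2 ^ k n))) \<le> exp (- x)"
        by simp
      also have "exp (- x) = 1 / real n" using n0 by (simp add: x_def exp_minus inverse_eq_divide)
      finally show ?thesis unfolding exp_add x_def .
    qed
    finally show ?case by simp
  qed
  have "(\<lambda>n. 2 / real n) \<longlonglongrightarrow> 0" by real_asymp
  then have "(\<lambda>n. measure_pmf.prob (random_graph n (p n)) {G. \<exists>c. set_colouring G (k n) c}) \<longlonglongrightarrow> 0"
    by (rule tendsto_sandwich[OF _ main tendsto_const, rotated]) simp
  then have "aas p (\<lambda>n G. y n \<le> real (set_chromatic_number G))"
    by (rule aas_le_set_chromatic_number) (intro always_eventually allI, unfold k_def, linarith)
  then show ?thesis by (simp only: y_def)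
qed

lemma smallo_1_iff: "f \<in> o(\<lambda>_. 1 :: real) \<longleftrightarrow> f \<longlonglongrightarrow> 0" for f :: "nat \<Rightarrow> real"
  by (auto intro: smalloI_tendsto dest: smalloD_tendsto)

text \<open>With b = 2 above and \<alpha> = 1 below, both thresholds are 2 / lg (1/s) =
  \<open>r_const q\<close>: the minimum s is attained at a fixed l, and it bounds every
  \<open>s_val\<close> from below.\<close>

lemma aas_set_chromatic_number_dense:
  fixes p :: "nat \<Rightarrow> real"
  assumes q: "0 < q" "q < 1" and p: "\<And>n. p n = q" and \<delta>: "0 < \<delta>"
  shows "aas p (\<lambda>n G. \<bar>real (set_chromatic_number G) / (r_const q * log 2 (real n)) - 1\<bar> < \<delta>)"
proof -
  \<comment> \<open>The bounds with \<open>d\<close> are not strict; halving yields the strict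
    inequality with \<delta>.\<close>
  define d where "d = \<delta> / 2"
  have d: "0 < d" "d < \<delta>" using \<delta> by (auto simp: d_def)
  define s where "s = s_const q"
  obtain l where l: "1 \<le> l" "s = s_val q l" using s_const_attained(1)[OF q] by (auto simp: s_def)
  have s: "0 < s" "s < 1"
    using s_const_attained(3)[OF q] s_val_bounds[of q l] q l by (auto simp: s_def)
  have s_min: "s \<le> s_val q m" for m using s_const_attained(2)[OF q] by (simp add: s_def)
  define b where "b = log 2 (1 / s)"
  have b: "0 < b" using s by (simp add: b_def)
  have r: "r_const q = 2 / b" by (simp add: r_const_def b_def s_def)
  have pp: "p = (\<lambda>_. q)" using p by auto
  \<comment> \<open>The constant q is n^(ln q / ln n), so n q = n^(1 + o(1)).\<close>
  have h: "(\<lambda>n. ln q / ln (real n)) \<longlonglongrightarrow> 0" by real_asymp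
  have upper: "aas p (\<lambda>n G. real (set_chromatic_number G) \<le> (1 + d) * (2 / b) * log 2 (real n))"
  proof (rule aas_set_chromatic_number_le[where h = "\<lambda>_. 0" and b = 2 and s = s and l = "\<lambda>_. l"])
    show "\<forall>\<^sub>F n in sequentially. (real n)\<^sup>2 * p n \<le> real n powr (2 + 0)"
      using eventually_gt_at_top[of 0]
      by eventually_elim (use q in \<open>simp add: p powr_realpow[of _ 2, simplified] mult_left_le\<close>)
    have "0 < (1 + d) * (2 / b)" using d b by simp
    then show "\<forall>\<^sub>F n in sequentially. (1 + d) * (2 / b) * log 2 (real n) * real l \<le> real n"
      by real_asymp
    show "2 < (1 + d) * (2 / b) * log 2 (1 / s)" using d b by (simp add: b_def[symmetric])
  qed (use q s d b l in \<open>auto simp: p\<close>)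
  have lower: "aas p (\<lambda>n G. (1 - d) * (2 / b) * log 2 (real n) \<le> real (set_chromatic_number G))"
  proof (rule aas_le_set_chromatic_number_log[where \<alpha> = 1 and s = s])
    show "(\<lambda>n. ln q / ln (real n)) \<longlonglongrightarrow> 0" by (rule h)
    show "\<forall>\<^sub>F n in sequentially. real n * p n = real n powr (1 + ln q / ln (real n))"
      using eventually_gt_at_top[of 1]
    proof eventually_elim
      case (elim n)
      then have "real n powr (1 + ln q / ln (real n)) = real n * real n powr (ln q / ln (real n))"
        by (simp add: powr_add)
      also have "real n powr (ln q / ln (real n)) = q" using elim q by (simp add: powr_def)
      finally show ?case by (simp add: p)
    qed
    show "(1 - d) * (2 / b) * log 2 (1 / s) < 2 * 1" using d b by (simp add: b_def[symmetric])
  qed (use q s s_min in \<open>auto simp: p\<close>)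
  have "\<forall>\<^sub>F n in sequentially. 0 < 2 / b * log 2 (real n)" using b by real_asymp
  then have "\<forall>\<^sub>F n in sequentially. \<forall>G :: nat ugraph.
      (1 - d) * (2 / b) * log 2 (real n) \<le> real (set_chromatic_number G) \<and>
      real (set_chromatic_number G) \<le> (1 + d) * (2 / b) * log 2 (real n) \<longrightarrow>
      \<bar>real (set_chromatic_number G) / (r_const q * log 2 (real n)) - 1\<bar> < \<delta>"
  proof eventually_elim
    case (elim n)
    define y where "y = 2 / b * log 2 (real n)"
    have "0 < y" using elim by (simp add: y_def)
    have "\<bar>t / y - 1\<bar> < \<delta>" if "(1 - d) * y \<le> t" "t \<le> (1 + d) * y" for t
    proof -
      have "1 - d \<le> t / y" "t / y \<le> 1 + d" using that \<open>0 < y\<close> by (auto simp: field_simps)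
      then show ?thesis using d by linarith
    qed
    then show ?case unfolding r y_def by (simp only: mult.assoc) blast
  qed
  then show ?thesis by (rule aas_mono[OF aas_conj[OF lower upper]])
qed

theorem theorem1p1:
  fixes \<epsilon> :: real and p :: "nat \<Rightarrow> real"
  assumes "0 < \<epsilon>" and "\<epsilon> < 1"
    and "filterlim (\<lambda>n. p n / ((ln (real n))\<^sup>2 * (ln (real n * p n))\<^sup>2 / real n)) at_top sequentially"
    and "\<forall>\<^sub>F n in sequentially. 0 \<le> p n \<and> p n \<le> 1 - \<epsilon>"
  shows
    "(\<forall>q. 0 < q \<and> q \<le> 1 - \<epsilon> \<and> (\<forall>n. p n = q) \<longrightarrow>
        (\<forall>\<delta>>0. aas p (\<lambda>n G.
           \<bar>real (set_chromatic_number G) / (r_const q * log 2 (real n)) - 1\<bar> < \<delta>)))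
     \<and>
     (\<forall>\<alpha>. 0 < \<alpha> \<and> \<alpha> \<le> 1 \<and> p \<in> o(\<lambda>_. 1) \<and>
        (\<exists>h. h \<in> o(\<lambda>_. 1) \<and>
           (\<forall>\<^sub>F n in sequentially. real n * p n = real n powr (\<alpha> + h n))) \<longrightarrow>
        (\<exists>f g. f \<in> o(\<lambda>_. 1) \<and> g \<in> o(\<lambda>_. 1) \<and>
           aas p (\<lambda>n G.
             (2 * \<alpha> + f n) * log 2 (real n) \<le> real (set_chromatic_number G) \<and>
             real (set_chromatic_number G) \<le> (1 + \<alpha> + g n) * log 2 (real n))))
     \<and>
     (filterlim (\<lambda>n. real n * p n) at_top sequentially \<and>
        (\<exists>h. h \<in> o(\<lambda>_. 1) \<and>
           (\<forall>\<^sub>F n in sequentially. real n * p n = real n powr h n)) \<longrightarrow>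
        (\<exists>g. g \<in> o(\<lambda>_. 1) \<and>
           aas p (\<lambda>n G.
             2 * (log 2 (real n * p n) - log 2 (ln (real n)) - log 2 (ln (real n * p n)))
               \<le> real (set_chromatic_number G) \<and>
             real (set_chromatic_number G) \<le> (1 + g n) * log 2 (real n))))"
proof (intro conjI allI impI; elim conjE exE)

  \<comment> \<open>Constant edge probability\<close>
  fix q \<delta> :: real
  assume "0 < q" "q \<le> 1 - \<epsilon>" "\<forall>n. p n = q" "0 < \<delta>"
  then show "aas p (\<lambda>n G. \<bar>real (set_chromatic_number G) / (r_const q * log 2 (real n)) - 1\<bar> < \<delta>)"
    using assms(1) by (intro aas_set_chromatic_number_dense) auto
next

  \<comment> \<open>Edge probability tending to 0 with polynomial average degree\<close>
  fix \<alpha> h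
  assume \<alpha>: "0 < \<alpha>" "\<alpha> \<le> 1" and p0: "p \<in> o(\<lambda>_. 1)" and h0: "h \<in> o(\<lambda>_. 1)"
    and np: "\<forall>\<^sub>F n in sequentially. real n * p n = real n powr (\<alpha> + h n)"
  have h: "h \<longlonglongrightarrow> 0" and p: "p \<longlonglongrightarrow> 0" using h0 p0 by (simp_all add: smallo_1_iff)
  have p_pos: "\<forall>\<^sub>F n in sequentially. 0 < p n"
    using np eventually_gt_at_top[of 0]
  proof eventually_elim
    case (elim n)
    then have "0 < real n powr (\<alpha> + h n)" by simp
    then have "0 < real n * p n" unfolding elim(1)[symmetric] .
    then show ?case by (simp add: zero_less_mult_iff)
  qed
  have p01: "\<forall>\<^sub>F n in sequentially. 0 < p n \<and> p n \<le> 1"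
    using p_pos assms(4) by eventually_elim (use assms(1) in auto)
  have "\<exists>g. g \<in> o(\<lambda>_. 1) \<and>
      aas p (\<lambda>n G. (2 * \<alpha> - g n) * log 2 (real n) \<le> real (set_chromatic_number G))"
  proof (rule aas_diagonal)
    fix \<delta> :: real assume "0 < \<delta>"
    \<comment> \<open>The universal lower bound 1/2 for \<open>s_val\<close> gives lg (1/s) = 1, so
      every constant below 2 \<alpha> is admissible.\<close>
    show "aas p (\<lambda>n G. (2 * \<alpha> - \<delta>) * log 2 (real n) \<le> real (set_chromatic_number G))"
    proof (rule aas_le_set_chromatic_number_log[OF p01 \<alpha> h np, where s = "1 / 2"])
      show "\<forall>\<^sub>F n in sequentially. \<forall>l. 1 / 2 \<le> s_val (p n) l"
        using p01 by eventually_elim (intro allI s_val_bounds, auto)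
    qed (use \<open>0 < \<delta>\<close> in auto)
  qed
  then obtain f where f: "f \<in> o(\<lambda>_. 1)"
      "aas p (\<lambda>n G. (2 * \<alpha> - f n) * log 2 (real n) \<le> real (set_chromatic_number G))" by blast
  have "\<exists>g. g \<in> o(\<lambda>_. 1) \<and>
      aas p (\<lambda>n G. real (set_chromatic_number G) \<le> (1 + \<alpha> + g n) * log 2 (real n))"
  proof (rule aas_diagonal)
    fix \<delta> :: real assume \<delta>: "0 < \<delta>"
    have "\<forall>\<^sub>F n in sequentially. (1 + \<alpha> + \<delta>) * log 2 (real n) \<le> real n powr (\<alpha> - \<alpha> / 2)"
      using \<alpha> \<delta> by real_asymp
    then have "\<forall>\<^sub>F n in sequentially. (1 + \<alpha> + \<delta>) * log 2 (real n) \<le> real n * p n"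
      using np powr_perturbation[OF h, of "\<alpha> / 2" \<alpha>, OF half_gt_zero[OF \<alpha>(1)]]
      by eventually_elim (elim conjE, simp only:)
    then show "aas p (\<lambda>n G. real (set_chromatic_number G) \<le> (1 + \<alpha> + \<delta>) * log 2 (real n))"
      by (rule aas_set_chromatic_number_le_sparse[OF p_pos p h np less_imp_le[OF \<alpha>(1)] \<delta>])
  qed
  then obtain g where g: "g \<in> o(\<lambda>_. 1)"
      "aas p (\<lambda>n G. real (set_chromatic_number G) \<le> (1 + \<alpha> + g n) * log 2 (real n))" by blast
  have "(\<lambda>n. - f n) \<in> o(\<lambda>_. 1)" using f(1) by simp
  moreover have "aas p (\<lambda>n G. (2 * \<alpha> + - f n) * log 2 (real n) \<le> real (set_chromatic_number G) \<and>
      real (set_chromatic_number G) \<le> (1 + \<alpha> + g n) * log 2 (real n))"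
    using aas_conj[OF f(2) g(2)] by simp
  ultimately show "\<exists>f g. f \<in> o(\<lambda>_. 1) \<and> g \<in> o(\<lambda>_. 1) \<and> aas p (\<lambda>n G.
      (2 * \<alpha> + f n) * log 2 (real n) \<le> real (set_chromatic_number G) \<and>
      real (set_chromatic_number G) \<le> (1 + \<alpha> + g n) * log 2 (real n))"
    using g(1) by blast
next

  \<comment> \<open>Average degree growing more slowly than any power\<close>
  fix h
  assume lim: "filterlim (\<lambda>n. real n * p n) at_top sequentially" and h0: "h \<in> o(\<lambda>_. 1)"
    and np: "\<forall>\<^sub>F n in sequentially. real n * p n = real n powr h n"
  have h: "h \<longlonglongrightarrow> 0" using h0 by (simp add: smallo_1_iff)
  \<comment> \<open>Because 3 exceeds e, this also yields ln (n p) \<ge> 1.\<close>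
  have np1: "\<forall>\<^sub>F n in sequentially. 3 \<le> real n * p n"
    using lim by (simp add: filterlim_at_top)
  have p_pos: "\<forall>\<^sub>F n in sequentially. 0 < p n"
    using np1
  proof eventually_elim
    case (elim n)
    then have "0 < real n * p n" by linarith
    then show ?case by (simp add: zero_less_mult_iff)
  qed
  have p01: "\<forall>\<^sub>F n in sequentially. 0 < p n \<and> p n \<le> 1"
    using p_pos assms(4) by eventually_elim (use assms(1) in auto)
  have dense: "\<forall>\<^sub>F n in sequentially. (ln (real n))\<^sup>2 * (ln (real n * p n))\<^sup>2 \<le> real n * p n"
  proof -
    have "\<forall>\<^sub>F n in sequentially. 1 \<le> p n / ((ln (real n))\<^sup>2 * (ln (real n * p n))\<^sup>2 / real n)"
      using assms(3) by (simp add: filterlim_at_top)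
    then show ?thesis
      using np1 eventually_gt_at_top[of 1]
    proof eventually_elim
      case (elim n)
      have "0 < (ln (real n))\<^sup>2 * (ln (real n * p n))\<^sup>2" using elim by simp
      then show ?case using elim by (simp add: le_divide_eq mult.commute)
    qed
  qed
  \<comment> \<open>As the exponent \<open>h\<close> tends to 0, eventually n p \<le> n^(1/2), that
    is p \<le> n^(-1/2).\<close>
  have p: "p \<longlonglongrightarrow> 0"
  proof (rule tendsto_sandwich[OF _ _ tendsto_const])
    show "\<forall>\<^sub>F n in sequentially. 0 \<le> p n" using p_pos by eventually_elim simp
    show "(\<lambda>n. real n powr (- 1 / 2)) \<longlonglongrightarrow> 0" by real_asymp
    show "\<forall>\<^sub>F n in sequentially. p n \<le> real n powr (- 1 / 2)"
      using np powr_perturbation[OF h half_gt_zero[OF zero_less_one], of 0] eventually_gt_at_top[of 0]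
    proof eventually_elim
      case (elim n)
      then have "real n * p n \<le> real n powr (1 / 2)" by simp
      also have "real n powr (1 / 2) = real n powr (1 + - 1 / 2)" by simp
      also have "\<dots> = real n * real n powr (- 1 / 2)"
        unfolding powr_add using elim by simp
      finally show ?case
        using elim(3) by (simp only: mult_le_cancel_left_pos of_nat_0_less_iff)
    qed
  qed
  have "\<exists>g. g \<in> o(\<lambda>_. 1) \<and>
      aas p (\<lambda>n G. real (set_chromatic_number G) \<le> (1 + g n) * log 2 (real n))"
  proof (rule aas_diagonal)
    fix \<delta> :: real assume \<delta>: "0 < \<delta>"
    \<comment> \<open>The growth condition on p gives n p \<ge> (ln n)^2, which dominates the number
      of colours; the sparse upper bound then applies with \<alpha> = 0.\<close>
    have "\<forall>\<^sub>F n::nat in sequentially. (1 + \<delta>) * log 2 (real n) \<le> (ln (real n))\<^sup>2"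
      using \<delta> by real_asymp
    then have "\<forall>\<^sub>F n in sequentially. (1 + \<delta>) * log 2 (real n) \<le> real n * p n"
      using np1 dense
    proof eventually_elim
      case (elim n)
      have "exp 1 \<le> real n * p n" using exp_le elim by linarith
      then have "1 \<le> ln (real n * p n)" using elim by (subst ln_ge_iff) auto
      then have "1 \<le> (ln (real n * p n))\<^sup>2" by simp
      then have "(ln (real n))\<^sup>2 * 1 \<le> (ln (real n))\<^sup>2 * (ln (real n * p n))\<^sup>2"
        by (intro mult_left_mono) auto
      then show ?case using elim by linarith
    qed
    then show "aas p (\<lambda>n G. real (set_chromatic_number G) \<le> (1 + \<delta>) * log 2 (real n))"
      using aas_set_chromatic_number_le_sparse[OF p_pos p h, of 0 \<delta>] np \<delta> by simp
  qed
  then obtain g where g: "g \<in> o(\<lambda>_. 1)"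
      "aas p (\<lambda>n G. real (set_chromatic_number G) \<le> (1 + g n) * log 2 (real n))" by blast
  show "\<exists>g. g \<in> o(\<lambda>_. 1) \<and> aas p (\<lambda>n G.
      2 * (log 2 (real n * p n) - log 2 (ln (real n)) - log 2 (ln (real n * p n)))
        \<le> real (set_chromatic_number G) \<and>
      real (set_chromatic_number G) \<le> (1 + g n) * log 2 (real n))"
    using g(1) aas_conj[OF aas_le_set_chromatic_number_very_sparse[OF p01 h np lim dense] g(2)] by blast
qed

end
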